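(* Let $n\ge 1$ and let $G=(B,E)$ be a graph with node set $B=\{0,1,\dots,n\}$ (undirected, with a loop at every node, as specified in the context). For any admittance matrix $Y$ on $G$ and any $S_1,\dots,S_n\in\mathbb{C}$, the number of isolated solutions in $(\mathbb{C}\setminus\{0\})^{2n}$ of the algebraic load flow equations $P_{G,Y}=\boldsymbol{0}$ is bounded above by $$\mu_G := \operatorname{NVol}_{2n}(\nabla_G),$$ the normalized volume of the symmetric adjacency polytope $\nabla_G$ of $G$.
   Context: **Graphs.** $G=(B,E)$ is a finite graph with node set $B=\{0,1,\dots,n\}$, where node $0$ is the reference node. The edge set $E\subseteq B\times B$ is a set of ordered pairs that is symmetric (if $(i,j)\in E$ then $(j,i)\in E$, i.e. $G$ is undirected), and $(i,i)\in E$ for every $i\in B$. **Admittance matrix on $G$.** A complex matrix $Y=(Y_{ij})_{i,j\in B}$ such that $Y_{ij}\neq 0$ if $(i,j)\in E$ and $Y_{ij}=0$ if $(i,j)\notin E$. $Y$ is not assumed to be symmetric. A superscript $*$ on a complex number denotes complex conjugation. **Algebraic load flow equations.** Fix a nonzero real constant $v_0$ and put $u_0=v_0$ (these are constants, not variables). Given $Y$ and $S_1,\dots,S_n\in\mathbb{C}$, the system $P_{G,Y}=\boldsymbol{0}$ consists of the $2n$ polynomial equations in the $2n$ independent complex variables $v_1,\dots,v_n,u_1,\dots,u_n$: $$\sum_{k=0}^{n} Y_{jk}^*\, v_j u_k - S_j = 0,\qquad \sum_{k=0}^{n} Y_{jk}\, u_j v_k - S_j^* = 0\qquad (j=1,\dots,n).$$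 The variables $u_k$ and $v_k$ are not required to be conjugate to each other. **Isolated solution.** A solution which is the only solution in some sufficiently small neighborhood of it. **Symmetric adjacency polytope.** Let $\mathbf{e}_0=\boldsymbol{0}\in\mathbb{R}^n$ and let $\mathbf{e}_1,\dots,\mathbf{e}_n$ be the standard basis of $\mathbb{R}^n$; $(\mathbf{e}_i,\mathbf{e}_j)\in\mathbb{R}^{2n}$ denotes concatenation. Put $\Gamma_G=\{(\mathbf{e}_i,\mathbf{e}_j):(i,j)\in E\}\subset\mathbb{R}^{2n}$ and $\nabla_G=\operatorname{conv}(\Gamma_G\cup\{\boldsymbol{0}\})$. **Normalized volume.** $\operatorname{NVol}_{2n}$ is the volume in $\mathbb{R}^{2n}$ normalized so that the standard corner simplex $\operatorname{conv}\{\boldsymbol{0},\text{standard basis vectors of }\mathbb{R}^{2n}\}$ has volume $1$; i.e. $\operatorname{NVol}_{2n}=(2n)!\cdot\operatorname{Vol}_{2n}$. The number $\mu_G$ is called the adjacency polytope bound (AP bound). *)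

theory Defs
  imports "HOL-Analysis.Analysis"
begin

text \<open>
  The number \<open>n \<ge> 1\<close> is \<open>CARD('n)\<close>.  The node set \<open>{0,1,...,n}\<close> is rendered as
  \<^typ>\<open>'n option\<close>: \<^term>\<open>None\<close> is the reference node \<open>0\<close> and \<^term>\<open>Some i\<close> are the nodes
  \<open>1,...,n\<close>.  Concatenations in \<open>R^(2n)\<close> and \<open>C^(2n)\<close> are pairs, whose Euclidean structure is
  the usual one of the product.
\<close>

definition loop_graph :: "('n option \<times> 'n option) set \<Rightarrow> bool" where
  "loop_graph E \<longleftrightarrow> sym E \<and> refl E"

definition admittance_matrix ::
    "('n::finite option \<times> 'n option) set \<Rightarrow> complex ^ ('n option) ^ ('n option) \<Rightarrow> bool" where
  "admittance_matrix E Y \<longleftrightarrow> (\<forall>i j. Y $ i $ j \<noteq> 0 \<longleftrightarrow> (i, j) \<in> E)"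

definition with_ref :: "real \<Rightarrow> complex ^ 'n::finite \<Rightarrow> 'n option \<Rightarrow> complex" where
  "with_ref c x k = (case k of None \<Rightarrow> complex_of_real c | Some i \<Rightarrow> x $ i)"

text \<open>The solutions \<open>(v, u)\<close> in \<open>C^(2n)\<close>; the constants \<open>v_0\<close> and \<open>u_0\<close> both equal \<open>v0\<close>.\<close>

definition load_flow_solutions ::
    "real \<Rightarrow> complex ^ ('n option) ^ ('n option) \<Rightarrow> complex ^ 'n::finite
      \<Rightarrow> ((complex ^ 'n) \<times> (complex ^ 'n)) set" where
  "load_flow_solutions v0 Y S = {(v, u). \<forall>j.
      (\<Sum>k\<in>UNIV. cnj (Y $ Some j $ k) * v $ j * with_ref v0 u k) - S $ j = 0 \<and>
      (\<Sum>k\<in>UNIV. Y $ Some j $ k * u $ j * with_ref v0 v k) - cnj (S $ j) = 0}"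

definition algebraic_torus :: "((complex ^ 'n::finite) \<times> (complex ^ 'n)) set" where
  "algebraic_torus = {(v, u). \<forall>i. v $ i \<noteq> 0 \<and> u $ i \<noteq> 0}"

definition node_vec :: "'n::finite option \<Rightarrow> real ^ 'n" where
  "node_vec k = (case k of None \<Rightarrow> 0 | Some i \<Rightarrow> axis i 1)"

definition adjacency_points ::
    "('n::finite option \<times> 'n option) set \<Rightarrow> ((real ^ 'n) \<times> (real ^ 'n)) set" where
  "adjacency_points E = {(node_vec i, node_vec j) | i j. (i, j) \<in> E}"

definition adjacency_polytope ::
    "('n::finite option \<times> 'n option) set \<Rightarrow> ((real ^ 'n) \<times> (real ^ 'n)) set" where
  "adjacency_polytope E = convex hull (adjacency_points E \<union> {0})"

definition normalized_volume :: "'a::euclidean_space set \<Rightarrow> real" where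
  "normalized_volume A = fact DIM('a) * measure lborel A"

lemma normalized_volume_corner_simplex:
  "normalized_volume (convex hull (insert 0 Basis) :: 'a::euclidean_space set) = 1"
  by (simp add: normalized_volume_def content_std_simplex)

definition ap_bound :: "('n::finite option \<times> 'n option) set \<Rightarrow> real" where
  "ap_bound E = normalized_volume (adjacency_polytope E)"

end

theory Submission
  imports Defs
begin

text \<open>
  The bound is an instance of Kushnirenko's theorem: \<open>N\<close> polynomials in \<open>N\<close> variables whose monomials
  have exponents in a finite set \<open>A\<close> have at most \<open>N!\<close> times the volume of the convex hull of \<open>A\<close>
  isolated common zeros in the torus.  The load flow equations have \<open>N = 2n\<close> variables, and their
  exponents are the points \<open>(e\<^sub>i, e\<^sub>j)\<close> of the adjacency polytope.

  The proof compares the growth of two numbers.  Let \<open>f = (f\<^sub>1, ..., f\<^sub>N)\<close>, let \<open>P\<close> be a finite set of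
  isolated zeros, and let \<open>h\<^sub>p\<close>, for \<open>p\<close> in \<open>P\<close>, be a product of combinations of monomials of \<open>A\<close> that is
  \<open>1\<close> at \<open>p\<close> and \<open>0\<close> on the rest of \<open>P\<close>.  The functions \<open>f^\<alpha> h\<^sub>p\<close> with \<open>|\<alpha>| \<le> k\<close> are linearly independent
  (lemma \<open>isolated_zeros_count_le_exponents\<close>), and there are about \<open>|P| k^N / N!\<close> of them.  All of them are
  combinations of monomials with exponents in a sumset of \<open>k + |P|\<close> copies of \<open>A\<close>, that is, of lattice
  points of the polytope dilated by \<open>k + |P|\<close>, and there are at most about \<open>k^N\<close> times the volume of those
  (lemma \<open>lattice_points_in_dilation_le_volume\<close>).  Division by \<open>k^N\<close> gives the bound
  (theorem \<open>isolated_zeros_le_normalized_volume\<close>).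

  Linear independence would be clear at zeros with invertible derivative, where the \<open>f\<^sub>j\<close> are local
  coordinates.  At a degenerate isolated zero \<open>p\<close> it is enough that \<open>f\<close> is open there: then
  there are points \<open>x \<rightarrow> p\<close> with \<open>f x = t y\<close>, \<open>t \<rightarrow> 0\<close>, for each direction \<open>y\<close>, and the lowest order part of a
  linear relation has to vanish at \<open>y\<close>.  Openness (lemma \<open>isolated_zero_imp_image_contains_ball\<close>) is
  obtained from the perturbations \<open>f x + s (x - p)\<close>, for which \<open>p\<close> is a regular zero.  For these the
  critical values lie in an algebraic hypersurface, again by a comparison of dimensions
  (lemma \<open>image_of_hypersurface_in_hypersurface\<close>).  As a complex hypersurface does not disconnect a
  ball, and as being attained is an open and closed condition on noncritical values, all values
  in a ball of a size that does not depend on \<open>s\<close> are attained.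

  The functions \<open>h\<^sub>p\<close> exist when the monomials of \<open>A\<close> separate the isolated zeros.  If every node is
  reachable from the reference node, the products \<open>v\<^sub>i u\<^sub>j\<close> along edges determine a point of the torus
  (lemma \<open>edge_monomials_separate_torus_points\<close>); otherwise the solutions in the torus come in curves,
  and none is isolated (lemma \<open>isolated_solution_imp_reachable\<close>).
\<close>

section \<open>Linear systems with more unknowns than equations\<close>

lemma underdetermined_system_nontrivial_solution:
  fixes a :: "'e \<Rightarrow> 'u \<Rightarrow> 'f::field"
  assumes "finite I" "finite J" "card I < card J"
  shows "\<exists>c. (\<exists>u\<in>J. c u \<noteq> 0) \<and> (\<forall>e\<in>I. (\<Sum>u\<in>J. a e u * c u) = 0)"
  using assms
proof (induction I arbitrary: J a rule: finite_induct)
  case empty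
  then obtain u where "u \<in> J" by fastforce
  then show ?case by (intro exI[of _ "\<lambda>_. 1"]) auto
next
  case (insert e I)
  show ?case
  proof (cases "\<forall>u\<in>J. a e u = 0")
    case True
    have "card I < card J" using insert by simp
    from insert.IH[OF \<open>finite J\<close> this, of a] True show ?thesis by auto
  next
    case False
    then obtain u0 where u0: "u0 \<in> J" "a e u0 \<noteq> 0" by auto
    define J' where "J' = J - {u0}"
    define a' where "a' = (\<lambda>e' u. a e' u - a e' u0 * a e u / a e u0)"
    have fJ': "finite J'" "u0 \<notin> J'" "J = insert u0 J'"
      using insert.prems u0 by (auto simp: J'_def)
    have "card I < card J'" using insert fJ' by simp
    from insert.IH[OF fJ'(1) this, of a'] obtain c
      where c: "\<exists>u\<in>J'. c u \<noteq> 0" "\<forall>e'\<in>I. (\<Sum>u\<in>J'. a' e' u * c u) = 0" by blast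
    define w where "w = - (\<Sum>u\<in>J'. a e u * c u) / a e u0"
    define d where "d = (\<lambda>u. if u = u0 then w else c u)"
    have split: "(\<Sum>u\<in>J. a e' u * d u) = a e' u0 * w + (\<Sum>u\<in>J'. a e' u * c u)" for e'
    proof -
      have "(\<Sum>u\<in>J'. a e' u * d u) = (\<Sum>u\<in>J'. a e' u * c u)"
        using fJ' by (intro sum.cong) (auto simp: d_def)
      then show ?thesis using fJ' by (simp add: d_def)
    qed
    have "(\<Sum>u\<in>J. a e' u * d u) = 0" if "e' \<in> insert e I" for e'
    proof (cases "e' = e")
      case True
      then show ?thesis using u0 by (simp add: split w_def)
    next
      case False
      with that have "e' \<in> I" by simp
      then have "0 = (\<Sum>u\<in>J'. a' e' u * c u)" using c by simp
      also have "\<dots> = (\<Sum>u\<in>J'. a e' u * c u) - a e' u0 / a e u0 * (\<Sum>u\<in>J'. a e u * c u)"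
        by (simp add: a'_def algebra_simps sum_subtractf sum_distrib_left)
      finally show ?thesis by (simp add: split w_def)
    qed
    moreover have "\<exists>u\<in>J. d u \<noteq> 0" using c(1) fJ' by (auto simp: d_def)
    ultimately show ?thesis by blast
  qed
qed

section \<open>Combinations of monomials\<close>

definition monomial :: "('i::finite \<Rightarrow> nat) \<Rightarrow> complex ^ 'i \<Rightarrow> complex" where
  "monomial a x = (\<Prod>i\<in>UNIV. (x $ i) ^ a i)"

definition combination_of :: "('i::finite \<Rightarrow> nat) set \<Rightarrow> (complex ^ 'i \<Rightarrow> complex) \<Rightarrow> bool" where
  "combination_of A f \<longleftrightarrow> (\<exists>c. \<forall>x. f x = (\<Sum>a\<in>A. c a * monomial a x))"

text \<open>Minkowski sums of exponent sets: products of combinations of monomials of \<open>A\<close> and of \<open>B\<close> are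
  combinations of monomials of \<open>A + B\<close>, and \<open>iterated_sum k A\<close> is the \<open>k\<close>-fold sum \<open>A + ... + A\<close>.\<close>

definition exponent_sum :: "('i \<Rightarrow> nat) set \<Rightarrow> ('i \<Rightarrow> nat) set \<Rightarrow> ('i \<Rightarrow> nat) set" where
  "exponent_sum A B = (\<lambda>(a, b) i. a i + b i) ` (A \<times> B)"

primrec iterated_sum :: "nat \<Rightarrow> ('i \<Rightarrow> nat) set \<Rightarrow> ('i \<Rightarrow> nat) set" where
  "iterated_sum 0 A = {\<lambda>_. 0}"
| "iterated_sum (Suc k) A = exponent_sum A (iterated_sum k A)"

lemma monomial_add: "monomial (\<lambda>i. a i + b i) x = monomial a x * monomial b x"
  by (simp add: monomial_def power_add prod.distrib)

lemma monomial_0 [simp]: "monomial (\<lambda>_. 0) x = 1"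
  by (simp add: monomial_def)

lemma finite_exponent_sum: "finite A \<Longrightarrow> finite B \<Longrightarrow> finite (exponent_sum A B)"
  by (simp add: exponent_sum_def)

lemma finite_iterated_sum: "finite A \<Longrightarrow> finite (iterated_sum k A)"
  by (induction k) (auto intro: finite_exponent_sum)

lemma iterated_sum_mono:
  assumes "(\<lambda>_. 0) \<in> A" "k \<le> l"
  shows "iterated_sum k A \<subseteq> iterated_sum l A"
proof -
  have "iterated_sum m A \<subseteq> iterated_sum (Suc m) A" for m
    using assms(1) by (force simp: exponent_sum_def)
  then show ?thesis using assms(2) by (rule lift_Suc_mono_le)
qed

lemma exponent_sum_iterated_sum:
  "exponent_sum (iterated_sum k A) (iterated_sum l A) \<subseteq> iterated_sum (k + l) A"
proof (induction k)
  case 0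
  then show ?case by (auto simp: exponent_sum_def)
next
  case (Suc k)
  show ?case
  proof
    fix z assume "z \<in> exponent_sum (iterated_sum (Suc k) A) (iterated_sum l A)"
    then obtain a b c where abc: "a \<in> A" "b \<in> iterated_sum k A" "c \<in> iterated_sum l A"
        "z = (\<lambda>i. (a i + b i) + c i)"
      by (auto simp: exponent_sum_def)
    have "(\<lambda>i. b i + c i) \<in> iterated_sum (k + l) A"
      using abc Suc by (force simp: exponent_sum_def)
    with abc show "z \<in> iterated_sum (Suc k + l) A"
      by (auto simp: exponent_sum_def add.assoc
          intro!: image_eqI[where x = "(a, \<lambda>i. b i + c i)"])
  qed
qed

lemma combination_of_mono:
  assumes "combination_of A f" "A \<subseteq> B" "finite B"
  shows "combination_of B f"
proof -
  from assms obtain c where c: "\<forall>x. f x = (\<Sum>a\<in>A. c a * monomial a x)"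
    by (auto simp: combination_of_def)
  have "f x = (\<Sum>a\<in>B. (if a \<in> A then c a else 0) * monomial a x)" for x
    unfolding c[rule_format] using assms(2,3) by (intro sum.mono_neutral_cong_left) auto
  then show ?thesis unfolding combination_of_def
    by (intro exI[of _ "\<lambda>a. if a \<in> A then c a else 0"]) auto
qed

lemma combination_of_monomial:
  assumes "a \<in> A" "finite A"
  shows "combination_of A (monomial a)"
proof -
  have "combination_of {a} (monomial a)"
    unfolding combination_of_def by (intro exI[of _ "\<lambda>_. 1"]) simp
  then show ?thesis by (rule combination_of_mono) (use assms in auto)
qed

lemma combination_of_cmult:
  assumes "combination_of A f"
  shows "combination_of A (\<lambda>x. k * f x)"
proof -
  from assms obtain c where c: "\<forall>x. f x = (\<Sum>a\<in>A. c a * monomial a x)"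
    by (auto simp: combination_of_def)
  then show ?thesis unfolding combination_of_def
    by (intro exI[of _ "\<lambda>a. k * c a"]) (simp add: sum_distrib_left mult.assoc)
qed

lemma combination_of_add:
  assumes "combination_of A f" "combination_of A g"
  shows "combination_of A (\<lambda>x. f x + g x)"
proof -
  from assms obtain c d where "\<forall>x. f x = (\<Sum>a\<in>A. c a * monomial a x)"
      "\<forall>x. g x = (\<Sum>a\<in>A. d a * monomial a x)"
    by (auto simp: combination_of_def)
  then show ?thesis unfolding combination_of_def
    by (intro exI[of _ "\<lambda>a. c a + d a"]) (simp add: sum.distrib algebra_simps)
qed

lemma combination_of_sum:
  assumes "\<And>j. j \<in> J \<Longrightarrow> combination_of A (f j)"
  shows "combination_of A (\<lambda>x. \<Sum>j\<in>J. f j x)"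
proof (cases "finite J")
  case True
  then show ?thesis using assms
  proof (induction J)
    case empty
    show ?case unfolding combination_of_def by (intro exI[of _ "\<lambda>_. 0"]) simp
  next
    case (insert j J)
    then show ?case by (simp add: combination_of_add)
  qed
next
  case False
  then show ?thesis unfolding combination_of_def by (intro exI[of _ "\<lambda>_. 0"]) simp
qed

lemma combination_of_mult:
  assumes "combination_of A f" "combination_of B g" "finite A" "finite B"
  shows "combination_of (exponent_sum A B) (\<lambda>x. f x * g x)"
proof -
  from assms obtain c d where c: "\<forall>x. f x = (\<Sum>a\<in>A. c a * monomial a x)"
      and d: "\<forall>x. g x = (\<Sum>a\<in>B. d a * monomial a x)"
    by (auto simp: combination_of_def)
  have eq: "f x * g x = (\<Sum>a\<in>A. \<Sum>b\<in>B. (c a * d b) * monomial (\<lambda>i. a i + b i) x)" for x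
    by (simp add: c d sum_product monomial_add mult_ac)
  show ?thesis unfolding eq
    by (intro combination_of_sum combination_of_cmult combination_of_monomial
        finite_exponent_sum assms) (auto simp: exponent_sum_def)
qed

lemma combination_of_iterated_mult:
  assumes "combination_of (iterated_sum k A) f" "combination_of (iterated_sum l A) g" "finite A"
  shows "combination_of (iterated_sum (k + l) A) (\<lambda>x. f x * g x)"
  using combination_of_mult[OF assms(1,2)] exponent_sum_iterated_sum assms(3)
  by (metis combination_of_mono finite_iterated_sum)

lemma combination_of_iterated_prod:
  assumes "finite J" "\<And>j. j \<in> J \<Longrightarrow> combination_of (iterated_sum (k j) A) (f j)" "finite A"
  shows "combination_of (iterated_sum (\<Sum>j\<in>J. k j) A) (\<lambda>x. \<Prod>j\<in>J. f j x)"
  using assms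
proof (induction J)
  case empty
  show ?case using combination_of_monomial[of "\<lambda>_. 0" "{\<lambda>_. 0}"]
    by (simp add: monomial_def[abs_def])
next
  case (insert j J)
  then show ?case by (simp add: combination_of_iterated_mult)
qed

lemma combination_of_iterated_power:
  assumes "combination_of (iterated_sum l A) f" "finite A"
  shows "combination_of (iterated_sum (m * l) A) (\<lambda>x. f x ^ m)"
  using combination_of_iterated_prod[of "{..<m}" "\<lambda>_. l" A "\<lambda>_. f"] assms by simp

lemma combination_of_iterated_1:
  assumes "combination_of A f"
  shows "combination_of (iterated_sum 1 A) f"
proof -
  have "iterated_sum 1 A = A" by (force simp: exponent_sum_def)
  with assms show ?thesis by simp
qed

text \<open>Distinct monomials are linearly independent as functions.  Doubling the coordinate in which
  two exponents differ multiplies the two monomials by different factors, which allows one of them to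
  be eliminated from a vanishing combination.\<close>

lemma monomials_linearly_independent:
  fixes A :: "('i::finite \<Rightarrow> nat) set"
  assumes "finite A" "\<And>x. (\<Sum>a\<in>A. c a * monomial a x) = 0" "a \<in> A"
  shows "c a = 0"
  using assms
proof (induction "card A" arbitrary: A c a rule: less_induct)
  case less
  show ?case
  proof (cases "A = {a}")
    case True
    then show ?thesis using less.prems(2)[of "\<chi> i. 1"] by (simp add: monomial_def)
  next
    case False
    then obtain b where b: "b \<in> A" "b \<noteq> a" using less.prems by auto
    then obtain i where i: "b i \<noteq> a i" by auto
    have double: "monomial e (\<chi> j. (if j = i then 2 else 1) * x $ j) = 2 ^ e i * monomial e x"
      for e and x :: "complex ^ 'i"
    proof -
      have "(\<Prod>j\<in>UNIV. (if j = i then 2 else 1) ^ e j) = (2 ^ e i :: complex)"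
        by (simp add: if_distrib[of "\<lambda>z. z ^ _"] cong: if_cong)
      then show ?thesis by (simp add: monomial_def power_mult_distrib prod.distrib)
    qed
    define d where "d = (\<lambda>e. c e * (2 ^ e i - 2 ^ b i))"
    have "(\<Sum>e\<in>A - {b}. d e * monomial e x) = 0" for x
    proof -
      have "(\<Sum>e\<in>A - {b}. d e * monomial e x) = (\<Sum>e\<in>A. d e * monomial e x)"
        using less.prems(1) b by (simp add: sum.remove[of A b] d_def)
      also have "\<dots> = (\<Sum>e\<in>A. c e * monomial e (\<chi> j. (if j = i then 2 else 1) * x $ j))
          - 2 ^ b i * (\<Sum>e\<in>A. c e * monomial e x)"
        unfolding double by (simp add: d_def algebra_simps sum_subtractf sum_distrib_left)
      finally show ?thesis using less.prems(2) by simp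
    qed
    moreover have "card (A - {b}) < card A"
      using less.prems(1) b(1) by (rule card_Diff1_less)
    ultimately have "d a = 0" using less.hyps[of "A - {b}" d a] less.prems b by auto
    moreover have "(2::complex) ^ a i \<noteq> 2 ^ b i"
    proof
      assume "(2::complex) ^ a i = 2 ^ b i"
      then have "norm ((2::complex) ^ a i) = norm ((2::complex) ^ b i)" by simp
      then show False using i by (simp add: norm_power)
    qed
    ultimately show ?thesis by (simp add: d_def)
  qed
qed

section \<open>Polynomial functions\<close>

inductive polyfun :: "(complex ^ 'i::finite \<Rightarrow> complex) \<Rightarrow> bool" where
  polyfun_const: "polyfun (\<lambda>_. c)"
| polyfun_coord: "polyfun (\<lambda>x. x $ i)"
| polyfun_add: "polyfun f \<Longrightarrow> polyfun g \<Longrightarrow> polyfun (\<lambda>x. f x + g x)"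
| polyfun_mult: "polyfun f \<Longrightarrow> polyfun g \<Longrightarrow> polyfun (\<lambda>x. f x * g x)"

lemma polyfun_sum: "(\<And>j. j \<in> J \<Longrightarrow> polyfun (f j)) \<Longrightarrow> polyfun (\<lambda>x. \<Sum>j\<in>J. f j x)"
  by (induction J rule: infinite_finite_induct) (auto intro: polyfun.intros)

lemma polyfun_prod: "(\<And>j. j \<in> J \<Longrightarrow> polyfun (f j)) \<Longrightarrow> polyfun (\<lambda>x. \<Prod>j\<in>J. f j x)"
  by (induction J rule: infinite_finite_induct) (auto intro: polyfun.intros)

lemma polyfun_power: "polyfun f \<Longrightarrow> polyfun (\<lambda>x. f x ^ m)"
  by (induction m) (auto intro: polyfun.intros)

lemma polyfun_combination: "polyfun (\<lambda>x. \<Sum>a\<in>A. c a * monomial a x)"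
  unfolding monomial_def
  by (intro polyfun_sum polyfun_mult polyfun_prod polyfun_power polyfun_const polyfun_coord)

lemma polyfun_of_combination: "combination_of A f \<Longrightarrow> polyfun f"
proof -
  assume "combination_of A f"
  then obtain c where "f = (\<lambda>x. \<Sum>a\<in>A. c a * monomial a x)"
    unfolding combination_of_def by blast
  then show "polyfun f" using polyfun_combination by simp
qed

text \<open>Restriction to complex lines takes the place of dimension theory for zero sets of polynomials: on
  a line, a polynomial is a polynomial in one variable, so it vanishes identically or at finitely many
  points.\<close>

lemma polyfun_on_line:
  assumes "polyfun f"
  shows "\<exists>q::complex poly. \<forall>z. f (a + z *s b) = poly q z"
  using assms
proof induction
  case (polyfun_const c)
  show ?case by (intro exI[of _ "[:c:]"]) simp
next
  case (polyfun_coord i)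
  show ?case by (intro exI[of _ "[:a $ i, b $ i:]"]) simp
next
  case (polyfun_add f g)
  then obtain p q where "\<forall>z. f (a + z *s b) = poly p z" "\<forall>z. g (a + z *s b) = poly q z" by blast
  then show ?case by (intro exI[of _ "p + q"]) simp
next
  case (polyfun_mult f g)
  then obtain p q where "\<forall>z. f (a + z *s b) = poly p z" "\<forall>z. g (a + z *s b) = poly q z" by blast
  then show ?case by (intro exI[of _ "p * q"]) simp
qed

lemma polyfun_finite_zeros_on_line:
  assumes "polyfun f" "f (a + w *s b) \<noteq> 0"
  shows "finite {z. f (a + z *s b) = 0}"
proof -
  obtain q where q: "\<forall>z. f (a + z *s b) = poly q z" using polyfun_on_line[OF assms(1)] by blast
  with assms(2) have "q \<noteq> 0" by auto
  then show ?thesis unfolding q[rule_format] by (rule poly_roots_finite)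
qed

lemma polyfun_has_derivative:
  fixes f :: "complex ^ 'i::finite \<Rightarrow> complex"
  assumes "polyfun f"
  shows "\<exists>D. (\<forall>i. polyfun (D i)) \<and>
    (\<forall>x. (f has_derivative (\<lambda>h. \<Sum>i\<in>UNIV. D i x * h $ i)) (at x))"
  using assms
proof induction
  case (polyfun_const c)
  show ?case by (intro exI[of _ "\<lambda>_ _. 0"]) (auto intro: polyfun.intros)
next
  case (polyfun_coord j)
  have "(\<Sum>i\<in>UNIV. (if i = j then 1 else 0) * h $ i) = h $ j" for h :: "complex ^ 'i"
    by (simp add: if_distrib[of "\<lambda>z. z * _"] cong: if_cong)
  moreover have "((\<lambda>x. x $ j) has_derivative (\<lambda>h. h $ j)) (at x)" for x :: "complex ^ 'i"
    by (rule bounded_linear_imp_has_derivative) (rule bounded_linear_vec_nth)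
  ultimately show ?case
    by (intro exI[of _ "\<lambda>i _. if i = j then 1 else 0"]) (auto intro: polyfun.intros)
next
  case (polyfun_add f g)
  then obtain D D' where D: "\<forall>i. polyfun (D i)" "\<forall>i. polyfun (D' i)"
      "\<forall>x. (f has_derivative (\<lambda>h. \<Sum>i\<in>UNIV. D i x * h $ i)) (at x)"
      "\<forall>x. (g has_derivative (\<lambda>h. \<Sum>i\<in>UNIV. D' i x * h $ i)) (at x)" by blast
  have "((\<lambda>x. f x + g x) has_derivative (\<lambda>h. \<Sum>i\<in>UNIV. (D i x + D' i x) * h $ i)) (at x)" for x
    using has_derivative_add[OF D(3)[rule_format, of x] D(4)[rule_format, of x]]
    by (simp add: algebra_simps sum.distrib)
  then show ?case using D(1,2)
    by (intro exI[of _ "\<lambda>i x. D i x + D' i x"]) (auto intro: polyfun.intros)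
next
  case (polyfun_mult f g)
  then obtain D D' where D: "\<forall>i. polyfun (D i)" "\<forall>i. polyfun (D' i)"
      "\<forall>x. (f has_derivative (\<lambda>h. \<Sum>i\<in>UNIV. D i x * h $ i)) (at x)"
      "\<forall>x. (g has_derivative (\<lambda>h. \<Sum>i\<in>UNIV. D' i x * h $ i)) (at x)" by blast
  have "((\<lambda>x. f x * g x) has_derivative
      (\<lambda>h. \<Sum>i\<in>UNIV. (f x * D' i x + D i x * g x) * h $ i)) (at x)" for x
    using has_derivative_mult[OF D(3)[rule_format, of x] D(4)[rule_format, of x]]
    by (simp add: algebra_simps sum.distrib sum_distrib_left)
  then show ?case using D(1,2) polyfun_mult.hyps
    by (intro exI[of _ "\<lambda>i x. f x * D' i x + D i x * g x"])
      (auto intro!: polyfun.polyfun_add polyfun.polyfun_mult)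
qed

lemma continuous_on_polyfun:
  assumes "polyfun f"
  shows "continuous_on S f"
  using polyfun_has_derivative[OF assms]
  by (meson continuous_at_imp_continuous_on has_derivative_continuous)

lemma polyfun_det:
  fixes J :: "complex ^ 'i::finite \<Rightarrow> complex ^ 'i ^ 'i"
  assumes "\<And>i j. polyfun (\<lambda>x. J x $ i $ j)"
  shows "polyfun (\<lambda>x. det (J x))"
  unfolding det_def by (intro polyfun_sum polyfun_mult polyfun_prod polyfun_const assms)

lemma polynomial_map_has_derivative:
  fixes g :: "complex ^ 'i::finite \<Rightarrow> complex ^ 'i"
  assumes "\<And>j. polyfun (\<lambda>x. g x $ j)"
  shows "\<exists>J. (\<forall>i j. polyfun (\<lambda>x. J x $ i $ j)) \<and> (\<forall>x. (g has_derivative (*v) (J x)) (at x))"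
proof -
  have "\<forall>j. \<exists>D. (\<forall>i. polyfun (D i)) \<and>
      (\<forall>x. ((\<lambda>x. g x $ j) has_derivative (\<lambda>h. \<Sum>i\<in>UNIV. D i x * h $ i)) (at x))"
    using polyfun_has_derivative[OF assms] by blast
  then obtain D where D: "\<And>j i. polyfun (D j i)"
      "\<And>j x. ((\<lambda>x. g x $ j) has_derivative (\<lambda>h. \<Sum>i\<in>UNIV. D j i x * h $ i)) (at x)"
    by metis
  define J where "J = (\<lambda>x. (\<chi> j i. D j i x) :: complex ^ 'i ^ 'i)"
  have "(g has_derivative (*v) (J x)) (at x)" for x
  proof -
    have Jh: "(J x *v h) $ j = (\<Sum>i\<in>UNIV. D j i x * h $ i)" for h j
      by (simp add: J_def matrix_vector_mult_def)
    show ?thesis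
      unfolding has_derivative_at_within
    proof (intro conjI vec_tendstoI)
      show "((\<lambda>y. ((g y - g x - J x *v (y - x)) /\<^sub>R norm (y - x)) $ j)
          \<longlongrightarrow> 0 $ j) (at x)" for j
        using D(2)[of j x] by (simp add: has_derivative_at_within Jh divideR_right)
    qed simp
  qed
  then show ?thesis using D(1) by (intro exI[of _ J]) (simp add: J_def)
qed

section \<open>Critical values of a polynomial map\<close>

definition exponent_box :: "nat \<Rightarrow> ('i \<Rightarrow> nat) set" where
  "exponent_box e = {a. \<forall>i. a i \<le> e}"

lemma exponent_box_eq_PiE: "exponent_box e = (UNIV \<rightarrow>\<^sub>E {..e})"
  by (auto simp: exponent_box_def PiE_def extensional_def)

lemma finite_exponent_box [simp]: "finite (exponent_box e :: ('i::finite \<Rightarrow> nat) set)"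
  unfolding exponent_box_eq_PiE by (intro finite_PiE) auto

lemma card_exponent_box: "card (exponent_box e :: ('i::finite \<Rightarrow> nat) set) = (e + 1) ^ CARD('i)"
  unfolding exponent_box_eq_PiE by (subst card_PiE) auto

lemma exponent_sum_box: "exponent_sum (exponent_box d) (exponent_box e) \<subseteq> exponent_box (d + e)"
  by (auto simp: exponent_sum_def exponent_box_def intro: add_mono)

lemma exponent_box_mono: "d \<le> e \<Longrightarrow> exponent_box d \<subseteq> exponent_box e"
  unfolding exponent_box_def using order_trans by blast

lemma zero_in_exponent_box: "(\<lambda>_. 0) \<in> exponent_box e"
  by (simp add: exponent_box_def)

lemma iterated_sum_box: "iterated_sum k (exponent_box e :: ('i \<Rightarrow> nat) set) \<subseteq> exponent_box (k * e)"
proof (induction k)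
  case (Suc k)
  have "iterated_sum (Suc k) (exponent_box e :: ('i \<Rightarrow> nat) set)
      \<subseteq> exponent_sum (exponent_box e) (exponent_box (k * e))"
    using Suc by (auto simp: exponent_sum_def)
  also have "\<dots> \<subseteq> exponent_box (e + k * e)" by (rule exponent_sum_box)
  finally show ?case by simp
qed (simp add: exponent_box_def)

lemma polyfun_imp_combination_of_box:
  assumes "polyfun f"
  shows "\<exists>e. combination_of (exponent_box e) f"
  using assms
proof induction
  case (polyfun_const c)
  have "combination_of (exponent_box 0) (\<lambda>x. c * monomial (\<lambda>_. 0) x :: complex)"
    by (intro combination_of_cmult combination_of_monomial zero_in_exponent_box finite_exponent_box)
  then show ?case by auto
next
  case (polyfun_coord i)
  have "(\<lambda>x. x $ i) = monomial (\<lambda>j. if j = i then 1 else 0)"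
    by (simp add: fun_eq_iff monomial_def if_distrib[of "\<lambda>m. _ ^ m"] cong: if_cong)
  moreover have "combination_of (exponent_box 1) (monomial (\<lambda>j. if j = i then 1 else 0))"
    by (intro combination_of_monomial finite_exponent_box) (simp add: exponent_box_def)
  ultimately show ?case by metis
next
  case (polyfun_add f g)
  then obtain d e where "combination_of (exponent_box d) f" "combination_of (exponent_box e) g"
    by blast
  then have "combination_of (exponent_box (d + e)) f" "combination_of (exponent_box (d + e)) g"
    using exponent_box_mono finite_exponent_box combination_of_mono
    by (metis le_add1, metis le_add2)
  then show ?case using combination_of_add by blast
next
  case (polyfun_mult f g)
  then obtain d e where "combination_of (exponent_box d) f" "combination_of (exponent_box e) g"
    by blast
  then show ?case using combination_of_mult exponent_sum_box combination_of_mono finite_exponent_box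
    by metis
qed

text \<open>Writing each \<open>F u\<close> in the monomials of \<open>A\<close> turns a linear relation between the \<open>F u\<close> into a linear
  system with one equation for each exponent in \<open>A\<close>.\<close>

lemma combinations_dependent:
  assumes "finite A" "finite U" "card A < card U" "\<And>u. u \<in> U \<Longrightarrow> combination_of A (F u)"
  shows "\<exists>c. (\<exists>u\<in>U. c u \<noteq> 0) \<and> (\<forall>x. (\<Sum>u\<in>U. c u * F u x) = 0)"
proof -
  have "\<forall>u\<in>U. \<exists>m. \<forall>x. F u x = (\<Sum>a\<in>A. m a * monomial a x)"
    using assms(4) by (auto simp: combination_of_def)
  then obtain m where m: "\<And>u x. u \<in> U \<Longrightarrow> F u x = (\<Sum>a\<in>A. m u a * monomial a x)" by metis
  obtain c where c: "\<exists>u\<in>U. c u \<noteq> 0" "\<forall>a\<in>A. (\<Sum>u\<in>U. m u a * c u) = 0"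
    using underdetermined_system_nontrivial_solution[OF assms(1-3), of "\<lambda>a u. m u a"] by blast
  have "(\<Sum>u\<in>U. c u * F u x) = 0" for x
  proof -
    have "(\<Sum>u\<in>U. c u * F u x) = (\<Sum>u\<in>U. \<Sum>a\<in>A. m u a * c u * monomial a x)"
      by (simp add: m sum_distrib_left mult_ac)
    also have "\<dots> = (\<Sum>a\<in>A. (\<Sum>u\<in>U. m u a * c u) * monomial a x)"
      by (subst sum.swap) (simp add: sum_distrib_right)
    also have "\<dots> = 0" using c(2) by simp
    finally show ?thesis .
  qed
  with c(1) show ?thesis by blast
qed

lemma combination_of_monomial_of_map:
  fixes g :: "complex ^ 'i::finite \<Rightarrow> complex ^ 'i"
  assumes "finite A" "(\<lambda>_. 0) \<in> A" "\<And>j. combination_of A (\<lambda>x. g x $ j)" "sum \<alpha> UNIV \<le> k"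
  shows "combination_of (iterated_sum k A) (\<lambda>x. monomial \<alpha> (g x))"
proof -
  have "combination_of (iterated_sum (\<Sum>j\<in>UNIV. \<alpha> j * 1) A) (\<lambda>x. \<Prod>j\<in>UNIV. g x $ j ^ \<alpha> j)"
    by (intro combination_of_iterated_prod combination_of_iterated_power
        combination_of_iterated_1 assms) simp
  then have "combination_of (iterated_sum (sum \<alpha> UNIV) A) (\<lambda>x. monomial \<alpha> (g x))"
    by (simp add: monomial_def)
  then show ?thesis using assms iterated_sum_mono finite_iterated_sum combination_of_mono by metis
qed

text \<open>Both \<open>(c k + d + 1)^N\<close> and \<open>(c k + 1)^N\<close> have leading term \<open>c^N k^N\<close>, so their difference is
  eventually smaller than \<open>(k + 1)^N\<close>.\<close>

lemma power_sum_growth: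
  fixes c d N :: nat
  shows "\<exists>k. (c * k + d + 1) ^ N < (k + 1) ^ N + (c * k + 1) ^ N"
proof -
  have lim: "(\<lambda>k. (real c * real k + b) / (real k + 1)) \<longlonglongrightarrow> real c" for b
  proof -
    have "(\<lambda>k. real c + (b - real c) * inverse (real (Suc k))) \<longlonglongrightarrow> real c + (b - real c) * 0"
      by (intro tendsto_intros LIMSEQ_inverse_real_of_nat)
    moreover have "real c + (b - real c) * inverse (real (Suc k)) = (real c * real k + b) / (real k + 1)"
      for k by (simp add: field_simps)
    ultimately show ?thesis by simp
  qed
  have "(\<lambda>k. ((real c * real k + real (d + 1)) / (real k + 1)) ^ N
      - ((real c * real k + 1) / (real k + 1)) ^ N) \<longlonglongrightarrow> real c ^ N - real c ^ N"
    by (intro tendsto_diff tendsto_power lim)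
  then have "eventually (\<lambda>k. ((real c * real k + real (d + 1)) / (real k + 1)) ^ N
      - ((real c * real k + 1) / (real k + 1)) ^ N < 1) sequentially"
    by (rule order_tendstoD) simp
  then obtain k where "((real c * real k + real (d + 1)) / (real k + 1)) ^ N
      - ((real c * real k + 1) / (real k + 1)) ^ N < 1"
    by (auto simp: eventually_sequentially)
  then have "(real c * real k + real (d + 1)) ^ N - (real c * real k + 1) ^ N < (real k + 1) ^ N"
    by (simp add: power_divide divide_less_eq flip: diff_divide_distrib)
  then have "real ((c * k + d + 1) ^ N) < real ((k + 1) ^ N + (c * k + 1) ^ N)"
    by (simp add: add_ac)
  then show ?thesis using of_nat_less_iff by blast
qed

text \<open>The image of the hypersurface \<open>J = 0\<close> is too small to be dense.  There are \<open>(k + 1)^N\<close> monomials in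
  the components of \<open>g\<close> with all exponents at most \<open>k\<close>, but modulo the multiples of \<open>J\<close> the polynomials
  of degree \<open>O(k)\<close> form a space of dimension only \<open>O(k^(N - 1))\<close>.  Hence some nonzero polynomial \<open>Q\<close> in the
  components of \<open>g\<close> is a multiple of \<open>J\<close>.  With \<open>J\<close> the Jacobian determinant of \<open>g\<close>, this confines the
  critical values of \<open>g\<close> to an algebraic hypersurface, which does not disconnect a ball.\<close>

lemma image_of_hypersurface_in_hypersurface:
  fixes g :: "complex ^ 'i::finite \<Rightarrow> complex ^ 'i"
  assumes g: "\<And>j. polyfun (\<lambda>x. g x $ j)" and J: "polyfun J" "J x0 \<noteq> 0"
  obtains Q y0 where "polyfun Q" "Q y0 \<noteq> 0" "\<And>x. J x = 0 \<Longrightarrow> Q (g x) = 0"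
proof -
  let ?N = "CARD('i)"
  have "\<forall>j. \<exists>e. combination_of (exponent_box e) (\<lambda>x. g x $ j)"
    using polyfun_imp_combination_of_box[OF g] by blast
  then obtain es where es: "\<And>j. combination_of (exponent_box (es j)) (\<lambda>x. g x $ j)" by metis
  define e where "e = Max (range es)"
  have e: "combination_of (exponent_box e) (\<lambda>x. g x $ j)" for j
    by (rule combination_of_mono[OF es exponent_box_mono]) (auto simp: e_def)
  obtain d where d: "combination_of (exponent_box d) J"
    using polyfun_imp_combination_of_box[OF J(1)] by blast
  define c where "c = ?N * e"
  obtain k where k: "(c * k + d + 1) ^ ?N < (k + 1) ^ ?N + (c * k + 1) ^ ?N"
    using power_sum_growth by blast
  define U where "U = (exponent_box k :: ('i \<Rightarrow> nat) set) <+> (exponent_box (c * k) :: ('i \<Rightarrow> nat) set)"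
  define A where "A = (exponent_box (c * k + d) :: ('i \<Rightarrow> nat) set)"
  define F where "F = (\<lambda>u x. case u of Inl \<alpha> \<Rightarrow> monomial \<alpha> (g x) | Inr \<beta> \<Rightarrow> J x * monomial \<beta> x)"
  have "combination_of A (F u)" if "u \<in> U" for u
  proof (cases u)
    case (Inl \<alpha>)
    with that have \<alpha>: "\<alpha> \<in> exponent_box k" by (auto simp: U_def)
    then have "sum \<alpha> UNIV \<le> of_nat ?N * k"
      by (intro sum_bounded_above) (auto simp: exponent_box_def)
    then have "combination_of (iterated_sum (?N * k) (exponent_box e)) (\<lambda>x. monomial \<alpha> (g x))"
      by (intro combination_of_monomial_of_map e zero_in_exponent_box finite_exponent_box) simp
    moreover have "iterated_sum (?N * k) (exponent_box e) \<subseteq> A"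
    proof -
      have "?N * k * e \<le> c * k + d" by (simp add: c_def)
      then show ?thesis unfolding A_def using iterated_sum_box exponent_box_mono by (meson subset_trans)
    qed
    ultimately show ?thesis using Inl
      by (auto simp: F_def A_def intro: combination_of_mono)
  next
    case (Inr \<beta>)
    with that have "\<beta> \<in> exponent_box (c * k)" by (auto simp: U_def)
    then have "combination_of (exponent_box (c * k)) (monomial \<beta>)"
      by (intro combination_of_monomial) auto
    then have "combination_of (exponent_sum (exponent_box d) (exponent_box (c * k)))
        (\<lambda>x. J x * monomial \<beta> x)"
      by (intro combination_of_mult d) auto
    then have "combination_of A (\<lambda>x. J x * monomial \<beta> x)"
      by (rule combination_of_mono) (use exponent_sum_box[of d "c * k"] in \<open>auto simp: A_def add.commute\<close>)
    then show ?thesis using Inr by (simp add: F_def)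
  qed
  moreover have "finite A" "finite U" by (auto simp: A_def U_def)
  moreover have "card A < card U"
    using k by (simp add: A_def U_def card_Plus card_exponent_box)
  ultimately obtain m where m: "\<exists>u\<in>U. m u \<noteq> 0" "\<And>x. (\<Sum>u\<in>U. m u * F u x) = 0"
    using combinations_dependent[of A U F] by blast
  define Q where "Q = (\<lambda>y. \<Sum>\<alpha>\<in>exponent_box k. m (Inl \<alpha>) * monomial \<alpha> y)"
  define H where "H = (\<lambda>x. \<Sum>\<beta>\<in>exponent_box (c * k). m (Inr \<beta>) * monomial \<beta> x)"
  have rel: "Q (g x) + J x * H x = 0" for x
    using m(2)[of x]
    by (simp add: U_def sum.Plus F_def Q_def H_def sum_distrib_left mult_ac)
  have polyQH: "polyfun Q" "polyfun H" by (simp_all add: Q_def H_def polyfun_combination)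
  have "\<exists>y0. Q y0 \<noteq> 0"
  proof (rule ccontr)
    assume "\<not> (\<exists>y0. Q y0 \<noteq> 0)"
    then have Q0: "Q y = 0" for y by blast
    have "m (Inl \<alpha>) = 0" if "\<alpha> \<in> exponent_box k" for \<alpha>
      by (rule monomials_linearly_independent[OF _ _ that]) (use Q0 in \<open>auto simp: Q_def\<close>)
    with m(1) obtain \<beta> where \<beta>: "\<beta> \<in> exponent_box (c * k)" "m (Inr \<beta>) \<noteq> 0" by (auto simp: U_def)
    have "\<exists>x1. H x1 \<noteq> 0"
    proof (rule ccontr)
      assume "\<not> (\<exists>x1. H x1 \<noteq> 0)"
      then have "m (Inr \<beta>) = 0"
        by (intro monomials_linearly_independent[OF _ _ \<beta>(1), of "\<lambda>b. m (Inr b)"]) (auto simp: H_def)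
      with \<beta>(2) show False by simp
    qed
    then obtain x1 where x1: "H x1 \<noteq> 0" by blast
    \<comment> \<open>If \<open>Q\<close> vanished identically, so would \<open>J H\<close>; but neither factor does, and on the line through
      points where they are nonzero each has only finitely many zeros.\<close>
    have "finite {z. J (x0 + z *s (x1 - x0)) = 0}"
      by (rule polyfun_finite_zeros_on_line[OF J(1), where w = 0]) (use J(2) in simp)
    moreover have "finite {z. H (x0 + z *s (x1 - x0)) = 0}"
      by (rule polyfun_finite_zeros_on_line[OF polyQH(2), where w = 1]) (use x1 in simp)
    ultimately have "finite ({z. J (x0 + z *s (x1 - x0)) = 0} \<union> {z. H (x0 + z *s (x1 - x0)) = 0})"
      by simp
    moreover have "{z. J (x0 + z *s (x1 - x0)) = 0} \<union> {z. H (x0 + z *s (x1 - x0)) = 0} = UNIV"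
      using rel Q0 by fastforce
    ultimately show False using infinite_UNIV_char_0[where ?'a = complex] by metis
  qed
  then obtain y0 where "Q y0 \<noteq> 0" by blast
  moreover have "Q (g x) = 0" if "J x = 0" for x using rel[of x] that by simp
  ultimately show ?thesis using that polyQH(1) by blast
qed

section \<open>Polynomial maps are open at isolated zeros\<close>

lemma norm_scalar_mult_complex: "norm (s *s x) = norm s * norm x" for x :: "complex ^ 'i::finite"
  by (simp add: norm_vec_def norm_mult L2_set_right_distrib)

lemma nonzero_set_of_polyfun_dense:
  assumes "polyfun Q" "Q y0 \<noteq> 0" "open S" "y \<in> S"
  shows "\<exists>y'\<in>S. Q y' \<noteq> 0"
proof -
  define L where "L = (\<lambda>z::complex. y + z *s (y0 - y))"
  have contL: "continuous_on UNIV L"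
    unfolding L_def by (intro continuous_intros continuous_on_vec_lambda
        | simp add: vector_scalar_mult_def)+
  have "finite {z. Q (L z) = 0}"
    unfolding L_def by (rule polyfun_finite_zeros_on_line[OF assms(1), where w = 1]) (use assms(2) in simp)
  moreover have "open (L -` S)" "0 \<in> L -` S"
    using contL assms(3,4) by (auto intro: open_vimage simp: L_def)
  then have "infinite (L -` S)"
    using finite_imp_not_open by blast
  ultimately have "\<not> L -` S \<subseteq> {z. Q (L z) = 0}" using finite_subset by blast
  then show ?thesis by blast
qed

lemma det_nonzero_imp_interior_image:
  fixes g :: "complex ^ 'i::finite \<Rightarrow> complex ^ 'i"
  assumes "\<And>x. (g has_derivative (*v) (J x)) (at x)" "det (J x) \<noteq> 0" "x \<in> interior T"
  shows "g x \<in> interior (g ` T)"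
proof -
  obtain B where B: "J x ** B = mat 1"
    using assms(2) by (metis invertible_det_nz invertible_def)
  show ?thesis
  proof (rule sussmann_open_mapping[where S = UNIV and g' = "(*v) B"])
    show "continuous_on UNIV g"
      using assms(1) by (meson continuous_at_imp_continuous_on has_derivative_continuous)
    show "(*v) (J x) \<circ> (*v) B = id"
      using B by (simp add: fun_eq_iff matrix_vector_mul_assoc)
  qed (use assms in auto)
qed

text \<open>Let \<open>Q = 0\<close> be a hypersurface that contains the critical values.  The attained values in the ball
  form a closed set, and off the hypersurface also an open one, since no preimage lies on the sphere.
  Two points of the ball off the hypersurface are connected in its complement along the complex line
  through them, from which only finitely many points are removed.  So all values off the hypersurface
  are attained as soon as one is, and the regular zero \<open>p\<close> provides that one.  The values on the
  hypersurface follow by density.\<close>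

lemma image_contains_ball_of_regular_zero:
  fixes g :: "complex ^ 'i::finite \<Rightarrow> complex ^ 'i"
  assumes g: "\<And>j. polyfun (\<lambda>x. g x $ j)"
    and J: "\<And>i j. polyfun (\<lambda>x. J x $ i $ j)" "\<And>x. (g has_derivative (*v) (J x)) (at x)"
    and p: "g p = 0" "det (J p) \<noteq> 0"
    and r: "r > 0" "\<And>x. dist p x = r \<Longrightarrow> m \<le> norm (g x)" and "m > 0"
  shows "ball 0 m \<subseteq> g ` cball p r"
proof -
  define K where "K = g ` cball p r"
  have contg: "continuous_on S g" for S
    using J(2) by (meson continuous_at_imp_continuous_on has_derivative_continuous)
  have "closed K"
    unfolding K_def by (intro compact_imp_closed compact_continuous_image contg) simp
  obtain Q y0 where Q: "polyfun Q" "Q y0 \<noteq> 0" "\<And>x. det (J x) = 0 \<Longrightarrow> Q (g x) = 0"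
    by (rule image_of_hypersurface_in_hypersurface[OF g polyfun_det[OF J(1)] p(2)]) blast
  have regular: "y \<in> interior K" if y: "y \<in> K" "y \<in> ball 0 m" "Q y \<noteq> 0" for y
  proof -
    from y(1) obtain x where x: "x \<in> cball p r" "y = g x" by (auto simp: K_def)
    have "dist p x \<noteq> r" using r(2)[of x] y(2) x(2) by auto
    with x have "x \<in> interior (cball p r)" by (simp add: interior_cball)
    moreover have "det (J x) \<noteq> 0" using Q(3) y(3) x(2) by auto
    ultimately show ?thesis
      using det_nonzero_imp_interior_image[OF J(2)] x(2) by (auto simp: K_def)
  qed
  have "0 \<in> interior K"
    using det_nonzero_imp_interior_image[where J = J and x = p and g = g and T = "cball p r"] J(2) p r(1)
    by (simp add: K_def interior_cball)
  then have "\<exists>y1\<in>interior K \<inter> ball 0 m. Q y1 \<noteq> 0"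
    by (intro nonzero_set_of_polyfun_dense[OF Q(1,2), where y = 0]) (use \<open>m > 0\<close> in auto)
  then obtain y1 where y1: "y1 \<in> K" "y1 \<in> ball 0 m" "Q y1 \<noteq> 0"
    using interior_subset by blast
  \<comment> \<open>Connectedness is used on the line through the attained value \<open>y1\<close> and \<open>y\<close>.\<close>
  have attained: "y \<in> K" if y: "y \<in> ball 0 m" "Q y \<noteq> 0" for y
  proof -
    define L where "L = (\<lambda>z::complex. y1 + z *s (y - y1))"
    have contL: "continuous_on S L" for S
      unfolding L_def by (intro continuous_intros continuous_on_vec_lambda
          | simp add: vector_scalar_mult_def)+
    define D where "D = L -` ball 0 m"
    define Z where "Z = {z. Q (L z) = 0}"
    have "open D" unfolding D_def by (intro open_vimage contL) auto
    have "convex D"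
    proof (rule convexI)
      fix a b :: complex and u v :: real
      assume ab: "a \<in> D" "b \<in> D" "0 \<le> u" "0 \<le> v" "u + v = 1"
      have "L (u *\<^sub>R a + v *\<^sub>R b) = u *\<^sub>R L a + v *\<^sub>R L b"
      proof -
        have "u *\<^sub>R y1 + v *\<^sub>R y1 = y1" using ab(5) by (metis scaleR_add_left scaleR_one)
        then show ?thesis
          by (simp add: L_def vec_eq_iff algebra_simps)
      qed
      then show "u *\<^sub>R a + v *\<^sub>R b \<in> D"
        using ab convexD[OF convex_ball[of 0 m]] by (simp add: D_def)
    qed
    have "finite Z"
      unfolding Z_def L_def by (rule polyfun_finite_zeros_on_line[OF Q(1), where w = 0]) (use y1 in simp)
    then have conn: "connected (D - Z)"
      by (intro connected_open_diff_countable \<open>open D\<close> convex_connected \<open>convex D\<close>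
          countable_finite) simp
    define T where "T = {z \<in> D - Z. L z \<in> K}"
    have T': "T = {z \<in> D - Z. L z \<in> interior K}"
      using regular interior_subset by (auto simp: T_def D_def Z_def)
    have "openin (top_of_set (D - Z)) T"
      unfolding T' using continuous_openin_preimage_gen[OF contL open_interior, of "D - Z" K]
      by (simp add: vimage_def Int_def)
    moreover have "closedin (top_of_set (D - Z)) T"
      unfolding T_def using continuous_closedin_preimage[OF contL \<open>closed K\<close>, of "D - Z"]
      by (simp add: vimage_def Int_def)
    moreover have "0 \<in> T" using y1 by (simp add: T_def D_def Z_def L_def)
    ultimately have "T = D - Z" using conn unfolding connected_clopen by blast
    moreover have "1 \<in> D - Z" using y by (simp add: D_def Z_def L_def)
    ultimately have "L 1 \<in> K" by (auto simp: T_def)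
    then show ?thesis by (simp add: L_def)
  qed
  show ?thesis
  proof
    fix y :: "complex ^ 'i" assume y: "y \<in> ball 0 m"
    show "y \<in> g ` cball p r"
    proof (rule ccontr)
      assume "y \<notin> g ` cball p r"
      then have "\<exists>y'\<in>ball 0 m - K. Q y' \<noteq> 0"
        using y \<open>closed K\<close>
        by (intro nonzero_set_of_polyfun_dense[OF Q(1,2), where y = y]) (auto simp: K_def)
      then show False using attained by blast
    qed
  qed
qed

text \<open>The determinant is a polynomial in \<open>s\<close>.  It is not zero, because \<open>A + s\<close> is invertible when \<open>s\<close>
  exceeds the operator norm of \<open>A\<close>.\<close>

lemma finite_singular_shifts:
  fixes A :: "complex ^ 'i::finite ^ 'i"
  shows "finite {s. det (A + mat s) = 0}"
proof -
  have entry: "\<exists>q. \<forall>s. (A + mat s) $ i $ j = poly q s" for i j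
    by (intro exI[of _ "[:A $ i $ j, if i = j then 1 else 0:]"]) (simp add: mat_def)
  then obtain q where q: "\<And>i j s. (A + mat s) $ i $ j = poly (q i j) s" by metis
  define D where "D = (\<Sum>\<pi> | \<pi> permutes UNIV. [:of_int (sign \<pi>):] * (\<Prod>i\<in>UNIV. q i (\<pi> i)))"
  have D: "det (A + mat s) = poly D s" for s
    unfolding det_def q by (simp add: D_def poly_sum poly_prod)
  obtain K where K: "K > 0" "\<And>x. norm (A *v x) \<le> K * norm x"
    using bounded_linear.pos_bounded[OF matrix_vector_mul_bounded_linear[of A]]
    by (auto simp: mult.commute)
  have "det (A + mat (of_real (K + 1))) \<noteq> 0"
  proof -
    have "x = 0" if "(A + mat (of_real (K + 1))) *v x = 0" for x
    proof -
      have "mat (of_real (K + 1)) *v x = (K + 1) *\<^sub>R x"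
        by (simp add: vec_eq_iff matrix_vector_mult_def mat_def if_distrib[of "\<lambda>z. z * _"]
            scaleR_conv_of_real[where 'a = complex] cong: if_cong)
      with that have "A *v x = - ((K + 1) *\<^sub>R x)"
        by (simp add: matrix_vector_mult_add_rdistrib eq_neg_iff_add_eq_0)
      with K(2)[of x] K(1) have "(K + 1) * norm x \<le> K * norm x" by simp
      then show "x = 0" by (simp add: distrib_right)
    qed
    then show ?thesis
      using invertible_det_nz invertible_left_inverse matrix_left_invertible_ker by metis
  qed
  then have "D \<noteq> 0" using D by auto
  then show ?thesis unfolding D by (rule poly_roots_finite)
qed

text \<open>An isolated zero may be degenerate, so the inverse function theorem does not apply to \<open>f\<close> itself.
  The maps \<open>f x + s (x - p)\<close> have \<open>p\<close> as a regular zero for arbitrarily small \<open>s\<close>, hence cover a ball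
  whose radius does not depend on \<open>s\<close>; compactness carries this over to \<open>s = 0\<close>.\<close>

lemma isolated_zero_imp_image_contains_ball:
  fixes f :: "complex ^ 'i::finite \<Rightarrow> complex ^ 'i"
  assumes f: "\<And>j. polyfun (\<lambda>x. f x $ j)"
    and p: "f p = 0" and r: "r > 0" "\<And>x. x \<in> cball p r \<Longrightarrow> f x = 0 \<Longrightarrow> x = p"
  shows "\<exists>\<delta>>0. ball 0 \<delta> \<subseteq> f ` cball p r"
proof -
  obtain J where J: "\<And>i j. polyfun (\<lambda>x. J x $ i $ j)" "\<And>x. (f has_derivative (*v) (J x)) (at x)"
    using polynomial_map_has_derivative[OF f] by blast
  have contf: "continuous_on S f" for S
    using J(2) by (meson continuous_at_imp_continuous_on has_derivative_continuous)
  obtain m where m: "m > 0" "\<And>x. dist p x = r \<Longrightarrow> m \<le> norm (f x)"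
  proof (cases "sphere p r = {}")
    case True
    then show ?thesis using that[of 1] r(1) by auto
  next
    case False
    moreover have "continuous_on (sphere p r) (\<lambda>x. norm (f x))"
      by (intro continuous_on_norm contf)
    ultimately obtain x0 where x0: "x0 \<in> sphere p r" "\<forall>x\<in>sphere p r. norm (f x0) \<le> norm (f x)"
      using continuous_attains_inf[of "sphere p r" "\<lambda>x. norm (f x)"] compact_sphere by blast
    have "f x0 \<noteq> 0" using r x0(1) by force
    with x0 show ?thesis using that[of "norm (f x0)"] by auto
  qed
  have "y \<in> f ` cball p r" if y: "y \<in> ball 0 (m / 2)" for y
  proof -
    \<comment> \<open>With \<open>norm s < \<epsilon> n\<close> the perturbation has norm at most \<open>m / 2\<close> on the sphere, so the perturbed map
      stays at distance \<open>m / 2\<close> from \<open>0\<close> there, for every \<open>n\<close>.\<close>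
    define \<epsilon> where "\<epsilon> = (\<lambda>n::nat. m / (2 * r) * inverse (real (Suc n)))"
    have \<epsilon>: "\<epsilon> n > 0" for n using m(1) r(1) by (simp add: \<epsilon>_def)
    have "\<exists>s x. norm s < \<epsilon> n \<and> x \<in> cball p r \<and> f x + s *s (x - p) = y" for n
    proof -
      have "infinite (ball (0::complex) (\<epsilon> n))"
        using \<epsilon> finite_imp_not_open[of "ball (0::complex) (\<epsilon> n)"] by (metis centre_in_ball empty_iff open_ball)
      then obtain s where s: "s \<in> ball 0 (\<epsilon> n)" "det (J p + mat s) \<noteq> 0"
        using finite_singular_shifts[of "J p"] finite_subset by (metis (mono_tags, lifting) mem_Collect_eq subsetI)
      define g where "g = (\<lambda>x. f x + s *s (x - p))"
      have "ball 0 (m / 2) \<subseteq> g ` cball p r"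
      proof (rule image_contains_ball_of_regular_zero[where J = "\<lambda>x. J x + mat s"])
        have "polyfun (\<lambda>x. f x $ j + s * (x $ j + - p $ j))" for j
          by (intro f polyfun_add polyfun_mult polyfun_const polyfun_coord)
        then show "polyfun (\<lambda>x. g x $ j)" for j
          by (simp add: g_def right_diff_distrib)
        show "polyfun (\<lambda>x. (J x + mat s) $ i $ j)" for i j
          using polyfun_add[OF J(1) polyfun_const] by (simp add: mat_def)
        show "(g has_derivative (*v) (J x + mat s)) (at x)" for x
        proof -
          have mats: "mat s *v h = s *s h" for h :: "complex ^ 'i"
            by (simp add: vec_eq_iff matrix_vector_mult_def mat_def if_distrib[of "\<lambda>z. z * _"] cong: if_cong)
          have sum: "(*v) (J x + mat s) = (\<lambda>h. J x *v h + s *s h)"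
            by (simp add: fun_eq_iff mats matrix_vector_mult_add_rdistrib)
          have "((\<lambda>x. mat s *v (x - p)) has_derivative (\<lambda>h. mat s *v (h - 0))) (at x)"
            by (intro bounded_linear.has_derivative[OF matrix_vector_mul_bounded_linear]
                has_derivative_diff has_derivative_ident has_derivative_const)
          from has_derivative_add[OF J(2)[of x] this] show ?thesis
            by (simp add: g_def mats sum)
        qed
        show "g p = 0" using p by (simp add: g_def)
        show "m / 2 \<le> norm (g x)" if "dist p x = r" for x
        proof -
          have "norm (s *s (x - p)) = norm s * r"
            unfolding norm_scalar_mult_complex using that by (simp add: dist_norm norm_minus_commute)
          also have "\<dots> \<le> \<epsilon> n * r" using s(1) r(1) by (intro mult_right_mono) auto
          also have "\<dots> = m / 2 / real (Suc n)" using r(1) by (simp add: \<epsilon>_def inverse_eq_divide del: of_nat_Suc)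
          also have "\<dots> \<le> m / 2 / 1" using m(1) by (intro divide_left_mono) auto
          finally show ?thesis
            using m(2)[OF that] norm_diff_ineq[of "f x" "s *s (x - p)"] by (simp add: g_def)
        qed
      qed (use s r(1) m(1) in auto)
      then obtain x where "x \<in> cball p r" "g x = y" using y by blast
      then show ?thesis using s(1) by (intro exI[of _ s] exI[of _ x]) (simp add: g_def)
    qed
    then obtain s x where sx: "\<And>n. norm (s n) < \<epsilon> n" "\<And>n. x n \<in> cball p r"
        "\<And>n. f (x n) + s n *s (x n - p) = y" by metis
    obtain l \<sigma> where l: "l \<in> cball p r" "strict_mono \<sigma>" "(x \<circ> \<sigma>) \<longlonglongrightarrow> l"
      using compact_cball[of p r] sx(2) unfolding compact_def by blast
    have "\<epsilon> \<longlonglongrightarrow> 0"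
      unfolding \<epsilon>_def
      by (rule tendsto_mult_right_zero) (rule LIMSEQ_inverse_real_of_nat)
    then have "s \<longlonglongrightarrow> 0"
      by (rule Lim_null_comparison[rotated]) (intro always_eventually allI less_imp_le sx(1))
    then have s\<sigma>: "(s \<circ> \<sigma>) \<longlonglongrightarrow> 0" using l(2) by (rule LIMSEQ_subseq_LIMSEQ)
    have "(\<lambda>n. y - (s \<circ> \<sigma>) n *s ((x \<circ> \<sigma>) n - p)) \<longlonglongrightarrow> y"
    proof (rule vec_tendstoI)
      fix i
      have "(\<lambda>n. y $ i - (s \<circ> \<sigma>) n * ((x \<circ> \<sigma>) n $ i - p $ i)) \<longlonglongrightarrow> y $ i - 0 * (l $ i - p $ i)"
        by (intro tendsto_diff tendsto_mult tendsto_const tendsto_vec_nth s\<sigma> l(3))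
      then show "(\<lambda>n. (y - (s \<circ> \<sigma>) n *s ((x \<circ> \<sigma>) n - p)) $ i) \<longlonglongrightarrow> y $ i"
        by (simp add: right_diff_distrib)
    qed
    moreover have "y - (s \<circ> \<sigma>) n *s ((x \<circ> \<sigma>) n - p) = f ((x \<circ> \<sigma>) n)" for n
      using sx(3)[of "\<sigma> n"] by (simp add: algebra_simps)
    ultimately have "(\<lambda>n. f ((x \<circ> \<sigma>) n)) \<longlonglongrightarrow> y" by simp
    moreover have "(\<lambda>n. f ((x \<circ> \<sigma>) n)) \<longlonglongrightarrow> f l"
      by (rule isCont_tendsto_compose[OF _ l(3)])
        (use contf[of UNIV] in \<open>simp add: continuous_on_eq_continuous_at\<close>)
    ultimately have "f l = y" using LIMSEQ_unique by blast
    with l(1) show ?thesis by blast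
  qed
  then show ?thesis using m(1) by (intro exI[of _ "m / 2"]) auto
qed

section \<open>Counting isolated zeros by counting exponents\<close>

definition exponents_of_degree_le :: "nat \<Rightarrow> ('i::finite \<Rightarrow> nat) set" where
  "exponents_of_degree_le k = {\<alpha>. sum \<alpha> UNIV \<le> k}"

lemma finite_exponents_of_degree_le: "finite (exponents_of_degree_le k :: ('i::finite \<Rightarrow> nat) set)"
proof (rule finite_subset)
  show "exponents_of_degree_le k \<subseteq> (exponent_box k :: ('i \<Rightarrow> nat) set)"
  proof
    fix \<alpha> :: "'i \<Rightarrow> nat" assume "\<alpha> \<in> exponents_of_degree_le k"
    moreover have "\<alpha> i \<le> sum \<alpha> UNIV" for i by (rule member_le_sum) auto
    ultimately show "\<alpha> \<in> exponent_box k"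
      by (force simp: exponents_of_degree_le_def exponent_box_def intro: order_trans)
  qed
qed simp

lemma monomial_scale: "monomial \<alpha> (t *s y) = t ^ sum \<alpha> UNIV * monomial \<alpha> y"
  by (simp add: monomial_def power_mult_distrib prod.distrib power_sum)

text \<open>These functions, which are \<open>1\<close> at one zero and \<open>0\<close> at the others, are what allows a relation between
  functions to be examined at one zero at a time.\<close>

lemma interpolation_by_products:
  assumes "finite A" "(\<lambda>_. 0) \<in> A" "finite P" "p \<in> P"
    and sep: "\<And>q. q \<in> P \<Longrightarrow> p \<noteq> q \<Longrightarrow> \<exists>a\<in>A. monomial a p \<noteq> monomial a q"
  shows "\<exists>h. combination_of (iterated_sum (card P) A) h \<and> h p = 1 \<and> (\<forall>q\<in>P - {p}. h q = 0)"
proof -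
  obtain a where a: "\<And>q. q \<in> P - {p} \<Longrightarrow> a q \<in> A \<and> monomial (a q) p \<noteq> monomial (a q) q"
    using sep by (metis DiffD1 DiffD2 insertCI)
  define factor where "factor = (\<lambda>q x. 1 / (monomial (a q) p - monomial (a q) q)
      * (monomial (a q) x + (- monomial (a q) q) * monomial (\<lambda>_. 0) x))"
  define h where "h = (\<lambda>x. \<Prod>q\<in>P - {p}. factor q x)"
  have "combination_of A (factor q)" if "q \<in> P - {p}" for q
    unfolding factor_def using a[OF that] assms(1,2)
    by (intro combination_of_cmult combination_of_add combination_of_monomial) auto
  then have "combination_of (iterated_sum (\<Sum>q\<in>P - {p}. 1) A) h"
    unfolding h_def using assms(1,3) by (intro combination_of_iterated_prod combination_of_iterated_1) auto
  moreover have "(\<Sum>q\<in>P - {p}. 1::nat) \<le> card P"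
    by (simp add: card_Diff1_le)
  ultimately have "combination_of (iterated_sum (card P) A) h"
    using combination_of_mono iterated_sum_mono[OF assms(2)] finite_iterated_sum[OF assms(1)] by metis
  moreover have "h p = 1"
    unfolding h_def by (intro prod.neutral) (use a in \<open>simp add: factor_def\<close>)
  moreover have "h q = 0" if "q \<in> P - {p}" for q
    using that assms(3) by (auto simp: h_def factor_def)
  ultimately show ?thesis by blast
qed

text \<open>Any direction \<open>y\<close> is approached by values of \<open>f\<close> near an isolated zero.  This is the form in which
  openness is used: a form that is not identically zero takes, for a suitable \<open>y\<close>, values at these
  points of exactly the order \<open>t^d\<close> given by its degree \<open>d\<close>, as if the components of \<open>f\<close> were independent
  coordinates.\<close>

lemma isolated_zero_ray_lifts:
  fixes f :: "complex ^ 'i::finite \<Rightarrow> complex ^ 'i"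
  assumes f: "\<And>j. polyfun (\<lambda>x. f x $ j)" and iso: "p isolated_in {x. f x = 0}"
  shows "\<exists>x t. x \<longlonglongrightarrow> p \<and> t \<longlonglongrightarrow> 0 \<and> (\<forall>n. t n \<noteq> 0 \<and> f (x n) = t n *s y)"
proof -
  have p: "f p = 0" using iso by (simp add: isolated_in_def)
  obtain r0 where r0: "r0 > 0" "\<And>x. f x = 0 \<Longrightarrow> dist p x < r0 \<Longrightarrow> x = p"
    using iso unfolding isolated_in_dist_Ex_iff by auto
  have "\<exists>x t. t \<noteq> 0 \<and> norm t \<le> inverse (real (Suc n)) \<and> dist x p \<le> inverse (real (Suc n))
      \<and> f x = t *s y" for n
  proof -
    define r where "r = min (r0 / 2) (inverse (real (Suc n)))"
    have "r > 0" "r < r0" using r0(1) by (auto simp: r_def)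
    then obtain \<delta> where \<delta>: "\<delta> > 0" "ball 0 \<delta> \<subseteq> f ` cball p r"
      using isolated_zero_imp_image_contains_ball[OF f p, of r] r0(2) by fastforce
    define t where "t = min (\<delta> / (2 * (norm y + 1))) (inverse (real (Suc n)))"
    have t: "t > 0" "t \<le> inverse (real (Suc n))" "t \<le> \<delta> / (2 * (norm y + 1))"
      using \<delta>(1) by (auto simp: t_def add_nonneg_pos)
    have "norm (of_real t *s y) = t * norm y"
      using t(1) by (simp add: norm_scalar_mult_complex)
    also have "\<dots> \<le> \<delta> / (2 * (norm y + 1)) * norm y" using t(3) by (intro mult_right_mono) auto
    also have "\<dots> < \<delta>"
    proof -
      have "\<delta> * norm y < \<delta> * (2 * (norm y + 1))"
        using \<delta>(1) by (intro mult_strict_left_mono) (auto simp: add_nonneg_pos add_pos_nonneg)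
      then show ?thesis by (simp add: divide_less_eq add_nonneg_pos)
    qed
    finally have "of_real t *s y \<in> ball 0 \<delta>" by simp
    then obtain x where "x \<in> cball p r" "f x = of_real t *s y" using \<delta>(2) by (metis imageE subsetD)
    then show ?thesis using t
      by (intro exI[of _ x] exI[of _ "of_real t"]) (auto simp: r_def dist_commute)
  qed
  then obtain x t where xt: "\<And>n. t n \<noteq> 0" "\<And>n. norm (t n) \<le> inverse (real (Suc n))"
      "\<And>n. dist (x n) p \<le> inverse (real (Suc n))" "\<And>n. f (x n) = t n *s y" by metis
  have "t \<longlonglongrightarrow> 0"
    by (rule Lim_null_comparison[OF _ LIMSEQ_inverse_real_of_nat]) (use xt(2) in auto)
  moreover have "x \<longlonglongrightarrow> p"
    by (rule metric_LIMSEQ_I, insert LIMSEQ_inverse_real_of_nat xt(3))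
      (metis (no_types, lifting) LIMSEQ_D abs_of_nonneg diff_zero inverse_nonnegative_iff_nonnegative le_less_trans of_nat_0_le_iff real_norm_def)
  ultimately show ?thesis using xt by blast
qed

text \<open>The functions \<open>f^\<alpha> h\<^sub>p\<close>, for \<open>|\<alpha>| \<le> k\<close> and \<open>p\<close> in \<open>P\<close>, are linearly independent, where \<open>h\<^sub>p\<close> is the
  interpolating function of \<open>p\<close>; since they are combinations of the monomials of \<open>(k + |P|) A\<close>, there
  are at most as many of them as of these monomials.  In a relation, take a term of lowest degree \<open>d\<close>
  in \<open>\<alpha>\<close>, say at \<open>p\<close>, follow points \<open>x \<rightarrow> p\<close> with \<open>f x = t y\<close> and \<open>t \<rightarrow> 0\<close>, and divide by \<open>t^d\<close>.  In the
  limit only the terms of degree \<open>d\<close> at \<open>p\<close> survive, so that the form they define vanishes at the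
  arbitrary point \<open>y\<close>, and its coefficients are zero.\<close>

lemma isolated_zeros_count_le_exponents:
  fixes f :: "complex ^ 'i::finite \<Rightarrow> complex ^ 'i"
  assumes A: "finite A" "(\<lambda>_. 0) \<in> A" and f: "\<And>j. combination_of A (\<lambda>x. f x $ j)"
    and P: "finite P" "\<And>p. p \<in> P \<Longrightarrow> p isolated_in {x. f x = 0}"
    and sep: "\<And>p q. p \<in> P \<Longrightarrow> q \<in> P \<Longrightarrow> p \<noteq> q \<Longrightarrow> \<exists>a\<in>A. monomial a p \<noteq> monomial a q"
  shows "card P * card (exponents_of_degree_le k :: ('i \<Rightarrow> nat) set)
    \<le> card (iterated_sum (k + card P) A)"
proof (rule ccontr)
  assume neg: "\<not> ?thesis"
  define D where "D = (exponents_of_degree_le k :: ('i \<Rightarrow> nat) set)"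
  define U where "U = D \<times> P"
  have fin: "finite D" "finite U" using P(1) by (auto simp: D_def U_def finite_exponents_of_degree_le)
  have less: "card (iterated_sum (k + card P) A) < card U"
    using neg by (simp add: U_def D_def card_cartesian_product mult.commute)
  have "\<forall>p\<in>P. \<exists>h. combination_of (iterated_sum (card P) A) h \<and> h p = 1 \<and> (\<forall>q\<in>P - {p}. h q = 0)"
    using interpolation_by_products[OF A P(1)] sep by blast
  then obtain h where h: "\<And>p. p \<in> P \<Longrightarrow> combination_of (iterated_sum (card P) A) (h p)"
      "\<And>p. p \<in> P \<Longrightarrow> h p p = 1" "\<And>p q. p \<in> P \<Longrightarrow> q \<in> P \<Longrightarrow> p \<noteq> q \<Longrightarrow> h p q = 0"
    by (metis Diff_iff empty_iff insert_iff)
  define F where "F = (\<lambda>(\<alpha>, p) x. monomial \<alpha> (f x) * h p x)"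
  have comb: "combination_of (iterated_sum (k + card P) A) (F u)" if uU: "u \<in> U" for u
  proof -
    obtain \<alpha> p where u: "u = (\<alpha>, p)" "sum \<alpha> UNIV \<le> k" "p \<in> P"
      using uU by (auto simp: U_def D_def exponents_of_degree_le_def)
    show ?thesis
      unfolding F_def u(1) prod.case
      by (intro combination_of_iterated_mult combination_of_monomial_of_map A f u(2) h(1) u(3))
  qed
  have "\<exists>c. (\<exists>u\<in>U. c u \<noteq> 0) \<and> (\<forall>x. (\<Sum>u\<in>U. c u * F u x) = 0)"
    using finite_iterated_sum[OF A(1)] fin(2) less comb by (rule combinations_dependent)
  then obtain c where c: "(\<exists>u\<in>U. c u \<noteq> 0) \<and> (\<forall>x. (\<Sum>u\<in>U. c u * F u x) = 0)" by (rule exE)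
  then have rel: "(\<Sum>u\<in>U. c u * F u x) = 0" for x by simp
  define d where "d = (LEAST d. \<exists>u\<in>U. c u \<noteq> 0 \<and> sum (fst u) UNIV = d)"
  have "\<exists>u\<in>U. c u \<noteq> 0 \<and> sum (fst u) UNIV = d"
    unfolding d_def by (rule LeastI_ex) (use c in blast)
  then obtain \<alpha>0 p where \<alpha>0: "\<alpha>0 \<in> D" "p \<in> P" "c (\<alpha>0, p) \<noteq> 0" "sum \<alpha>0 UNIV = d"
    by (auto simp: U_def)
  have lowest: "c u = 0" if "u \<in> U" "sum (fst u) UNIV < d" for u
    using not_less_Least[of "sum (fst u) UNIV" "\<lambda>d. \<exists>u\<in>U. c u \<noteq> 0 \<and> sum (fst u) UNIV = d"] that
    by (auto simp: d_def)
  define D' where "D' = {\<alpha> \<in> D. sum \<alpha> UNIV = d}"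
  have "\<exists>y. (\<Sum>\<alpha>\<in>D'. c (\<alpha>, p) * monomial \<alpha> y) \<noteq> 0"
  proof (rule ccontr)
    assume "\<not> ?thesis"
    then have "c (\<alpha>0, p) = 0"
      using \<alpha>0 fin(1)
      by (intro monomials_linearly_independent[of D' "\<lambda>\<alpha>. c (\<alpha>, p)" \<alpha>0]) (auto simp: D'_def)
    with \<alpha>0(3) show False by simp
  qed
  then obtain y where y: "(\<Sum>\<alpha>\<in>D'. c (\<alpha>, p) * monomial \<alpha> y) \<noteq> 0" by blast
  obtain x t where xt: "x \<longlonglongrightarrow> p" "t \<longlonglongrightarrow> 0" "\<And>n. t n \<noteq> 0" "\<And>n. f (x n) = t n *s y"
    using isolated_zero_ray_lifts[OF polyfun_of_combination[OF f] P(2)[OF \<alpha>0(2)]] by metis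
  \<comment> \<open>The term of the relation with index \<open>(\<alpha>, q)\<close> at \<open>z\<close>, where \<open>f z = s y\<close>, after division by \<open>s^d\<close>;
    at \<open>s = 0\<close> the power \<open>0^0 = 1\<close> keeps exactly the terms of degree \<open>d\<close>.\<close>
  define w where "w = (\<lambda>s (\<alpha>, q) z. c (\<alpha>, q) * (if sum \<alpha> UNIV < d then 0 else s ^ (sum \<alpha> UNIV - d))
      * monomial \<alpha> y * h q z)"
  have zero: "(\<Sum>u\<in>U. w (t n) u (x n)) = 0" for n
  proof -
    have "c u * F u (x n) = t n ^ d * w (t n) u (x n)" if "u \<in> U" for u
    proof (cases u)
      case (Pair \<alpha> q)
      show ?thesis
      proof (cases "sum \<alpha> UNIV < d")
        case True
        then show ?thesis using lowest[OF that] Pair by (simp add: w_def)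
      next
        case False
        then have "t n ^ sum \<alpha> UNIV = t n ^ d * t n ^ (sum \<alpha> UNIV - d)"
          by (simp flip: power_add)
        then show ?thesis using False Pair by (simp add: w_def F_def xt(4) monomial_scale)
      qed
    qed
    then have "t n ^ d * (\<Sum>u\<in>U. w (t n) u (x n)) = 0"
      using rel[of "x n"] by (simp add: sum_distrib_left)
    then show ?thesis using xt(3) by simp
  qed
  have "(\<lambda>n. w (t n) u (x n)) \<longlonglongrightarrow> w 0 u p" if "u \<in> U" for u
  proof (cases u)
    case (Pair \<alpha> q)
    with that have "q \<in> P" by (simp add: U_def)
    then have "continuous_on UNIV (h q)"
      using h(1) polyfun_of_combination continuous_on_polyfun by blast
    then have "(\<lambda>n. h q (x n)) \<longlonglongrightarrow> h q p"
      using xt(1) by (auto simp: continuous_on_eq_continuous_at intro: isCont_tendsto_compose)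
    then show ?thesis unfolding w_def Pair using xt(2)
      by (cases "sum \<alpha> UNIV < d") (auto intro!: tendsto_intros)
  qed
  then have "(\<lambda>n. \<Sum>u\<in>U. w (t n) u (x n)) \<longlonglongrightarrow> (\<Sum>u\<in>U. w 0 u p)"
    by (rule tendsto_sum)
  then have "(\<Sum>u\<in>U. w 0 u p) = 0" unfolding zero by (simp add: LIMSEQ_const_iff)
  moreover have "(\<Sum>u\<in>U. w 0 u p) = (\<Sum>\<alpha>\<in>D'. c (\<alpha>, p) * monomial \<alpha> y)"
  proof -
    have "(\<Sum>u\<in>U. w 0 u p) = (\<Sum>u\<in>(\<lambda>\<alpha>. (\<alpha>, p)) ` D'. w 0 u p)"
    proof (rule sum.mono_neutral_right[OF fin(2)])
      show "(\<lambda>\<alpha>. (\<alpha>, p)) ` D' \<subseteq> U" using \<alpha>0(2) by (auto simp: U_def D'_def)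
      show "\<forall>u\<in>U - (\<lambda>\<alpha>. (\<alpha>, p)) ` D'. w 0 u p = 0"
      proof
        fix u assume u: "u \<in> U - (\<lambda>\<alpha>. (\<alpha>, p)) ` D'"
        obtain \<alpha> q where aq: "u = (\<alpha>, q)" by (cases u)
        show "w 0 u p = 0"
        proof (cases "q = p")
          case True
          with u aq have "sum \<alpha> UNIV \<noteq> d" by (auto simp: U_def D'_def)
          then show ?thesis by (simp add: w_def aq)
        next
          case False
          then show ?thesis using u aq h(3) \<alpha>0(2) by (simp add: w_def U_def)
        qed
      qed
    qed
    also have "\<dots> = (\<Sum>\<alpha>\<in>D'. w 0 (\<alpha>, p) p)"
      by (subst sum.reindex) (auto simp: inj_on_def)
    also have "\<dots> = (\<Sum>\<alpha>\<in>D'. c (\<alpha>, p) * monomial \<alpha> y)"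
      using h(2)[OF \<alpha>0(2)] by (intro sum.cong) (auto simp: w_def D'_def)
    finally show ?thesis .
  qed
  ultimately show False using y by simp
qed

section \<open>Lattice points and volume\<close>

lemma card_exponents_on_subset:
  fixes I :: "'i::finite set"
  shows "card {\<alpha>::'i \<Rightarrow> nat. (\<forall>i. i \<notin> I \<longrightarrow> \<alpha> i = 0) \<and> sum \<alpha> I \<le> k} = (card I + k) choose card I"
    (is "card (?S I k) = _")
proof -
  have "finite I" by simp
  then show ?thesis
  proof (induction I arbitrary: k rule: finite_induct)
    case empty
    have "?S {} k = {\<lambda>_. 0}" by auto
    then show ?case by simp
  next
    case (insert i I)
    have "bij_betw (\<lambda>\<alpha>. (\<alpha> i, \<alpha>(i := 0))) (?S (insert i I) k) (SIGMA j:{..k}. ?S I (k - j))"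
    proof (rule bij_betw_byWitness[where f' = "\<lambda>(j, \<alpha>). \<alpha>(i := j)"])
      have "sum (\<alpha>(i := j)) I = sum \<alpha> I" for \<alpha> :: "'i \<Rightarrow> nat" and j
        using insert.hyps by (intro sum.cong) auto
      then show "(\<lambda>\<alpha>. (\<alpha> i, \<alpha>(i := 0))) ` ?S (insert i I) k \<subseteq> (SIGMA j:{..k}. ?S I (k - j))"
          "(\<lambda>(j, \<alpha>). \<alpha>(i := j)) ` (SIGMA j:{..k}. ?S I (k - j)) \<subseteq> ?S (insert i I) k"
        using insert.hyps by auto
    qed (use insert.hyps in \<open>auto simp: fun_eq_iff\<close>)
    then have "card (?S (insert i I) k) = card (SIGMA j:{..k}. ?S I (k - j))"
      by (rule bij_betw_same_card)
    also have "\<dots> = (\<Sum>j\<le>k. card (?S I (k - j)))"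
    proof (rule card_SigmaI)
      have "finite (?S I m)" for m
      proof -
        have "card (?S I m) > 0" by (simp add: insert.IH)
        then show ?thesis by (rule card_ge_0_finite)
      qed
      then show "\<forall>j\<in>{..k}. finite (?S I (k - j))" by blast
    qed simp
    also have "\<dots> = (\<Sum>j\<le>k. (card I + (k - j)) choose card I)" by (simp add: insert.IH)
    also have "\<dots> = (\<Sum>j\<le>k. (card I + j) choose card I)"
      by (rule sum.reindex_bij_witness[of _ "\<lambda>j. k - j" "\<lambda>j. k - j"]) auto
    also have "\<dots> = (card I + k + 1) choose (card I + 1)" by (rule choose_rising_sum)
    finally show ?case using insert.hyps by simp
  qed
qed

lemma power_le_card_exponents_of_degree_le:
  "real k ^ CARD('i) \<le> fact (CARD('i)) * real (card (exponents_of_degree_le k :: ('i::finite \<Rightarrow> nat) set))"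
proof -
  have "fact k * real k ^ m \<le> fact (m + k)" for m
  proof (induction m)
    case (Suc m)
    have "fact k * real k ^ Suc m = real k * (fact k * real k ^ m)" by simp
    also have "\<dots> \<le> real (Suc (m + k)) * fact (m + k)" using Suc by (intro mult_mono) auto
    finally show ?case by simp
  qed simp
  then have "fact k * real k ^ CARD('i) \<le> fact (CARD('i) + k)" .
  also have "\<dots> = fact (CARD('i)) * fact k * real ((CARD('i) + k) choose CARD('i))"
    using binomial_fact_lemma[of "CARD('i)" "CARD('i) + k"]
    by (metis add_diff_cancel_left' le_add1 of_nat_fact of_nat_mult)
  finally have "real k ^ CARD('i) \<le> fact (CARD('i)) * real ((CARD('i) + k) choose CARD('i))"
    by (simp add: mult.commute mult.left_commute mult_le_cancel_left_pos)
  then show ?thesis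
    using card_exponents_on_subset[of "UNIV :: 'i set" k] by (simp add: exponents_of_degree_le_def)
qed

text \<open>Cubes of side \<open>1/k\<close> around the points of \<open>K\<close> with coordinates in \<open>(1/k) \<int>\<close> are disjoint and lie
  in a small neighbourhood of \<open>K\<close>, whose volume is close to that of \<open>K\<close>.\<close>

lemma lattice_points_in_dilation_le_volume:
  fixes K :: "'a::euclidean_space set"
  assumes "compact K" "\<epsilon> > 0"
  obtains k0 :: nat where "k0 > 0"
    and "\<And>k Z. k \<ge> k0 \<Longrightarrow> finite Z \<Longrightarrow> (\<And>z b. z \<in> Z \<Longrightarrow> b \<in> Basis \<Longrightarrow> z \<bullet> b \<in> \<int>) \<Longrightarrow>
      (\<And>z. z \<in> Z \<Longrightarrow> z /\<^sub>R real k \<in> K) \<Longrightarrow>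
      real (card Z) \<le> real k ^ DIM('a) * (measure lborel K + \<epsilon>)"
proof -
  define C where "C = (\<lambda>m::nat. \<Union>x\<in>K. \<Union>y\<in>cball 0 (inverse (real (Suc m))). {x + y})"
  have compC: "compact (C m)" for m
    unfolding C_def by (intro compact_sums' assms) simp
  have measC: "C m \<in> fmeasurable lborel" for m
    using compC[of m] by (rule fmeasurable_compact)
  have "(\<Inter>m. C m) = K"
  proof
    show "K \<subseteq> (\<Inter>m. C m)" by (force simp: C_def)
    show "(\<Inter>m. C m) \<subseteq> K"
    proof
      fix x assume x: "x \<in> (\<Inter>m. C m)"
      have "x \<in> closure K"
        unfolding closure_approachable
      proof (intro allI impI)
        fix e :: real assume "e > 0"
        then obtain m where m: "inverse (real (Suc m)) < e" using reals_Archimedean by blast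
        from x have "x \<in> C m" by blast
        then obtain u v where "u \<in> K" "norm v \<le> inverse (real (Suc m))" "x = u + v"
          by (auto simp: C_def)
        then show "\<exists>y\<in>K. dist y x < e" using m by (intro bexI[of _ u]) (auto simp: dist_norm)
      qed
      then show "x \<in> K" using assms(1) by (simp add: compact_imp_closed)
    qed
  qed
  moreover have "(\<lambda>m. measure lborel (C m)) \<longlonglongrightarrow> measure lborel (\<Inter>m. C m)"
  proof (rule Lim_measure_decseq)
    show "range C \<subseteq> sets lborel" using measC by (auto simp: fmeasurable_def)
    show "decseq C"
    proof (rule decseq_SucI)
      fix m
      have "inverse (real (Suc (Suc m))) \<le> inverse (real (Suc m))" by (simp add: field_simps)
      then show "C (Suc m) \<subseteq> C m" unfolding C_def by (intro UN_mono subset_cball order_refl) auto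
    qed
    show "emeasure lborel (C m) \<noteq> \<infinity>" for m using measC[of m] by (auto simp: fmeasurable_def)
  qed
  ultimately have "(\<lambda>m. measure lborel (C m)) \<longlonglongrightarrow> measure lborel K" by simp
  then have "eventually (\<lambda>m. measure lborel (C m) < measure lborel K + \<epsilon>) sequentially"
    by (rule order_tendstoD) (use assms(2) in simp)
  then obtain m where m: "measure lborel (C m) < measure lborel K + \<epsilon>"
    by (auto simp: eventually_sequentially)
  define k0 where "k0 = DIM('a) * Suc m"
  have "k0 > 0" by (simp add: k0_def)
  have bound: "real (card Z) \<le> real k ^ DIM('a) * (measure lborel K + \<epsilon>)"
    if k: "k \<ge> k0" and Z: "finite Z" "\<And>z b. z \<in> Z \<Longrightarrow> b \<in> Basis \<Longrightarrow> z \<bullet> b \<in> \<int>"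
      "\<And>z. z \<in> Z \<Longrightarrow> z /\<^sub>R real k \<in> K" for k and Z :: "'a set"
  proof -
    have kpos: "k > 0" using \<open>k0 > 0\<close> k by linarith
    define \<eta> where "\<eta> = 1 / (2 * real k)"
    have \<eta>: "\<eta> > 0" using kpos by (simp add: \<eta>_def)
    define B where "B = (\<lambda>z::'a. box (z /\<^sub>R real k - \<eta> *\<^sub>R One) (z /\<^sub>R real k + \<eta> *\<^sub>R One))"
    have inB: "\<bar>x \<bullet> b - (z \<bullet> b) / real k\<bar> < \<eta>" if "x \<in> B z" "b \<in> Basis" for x z b
      using that by (auto simp: B_def mem_box algebra_simps abs_less_iff divide_inverse)
    have volB: "measure lborel (B z) = (1 / real k) ^ DIM('a)" for z
      using \<eta> by (simp add: B_def measure_lborel_box_eq algebra_simps \<eta>_def)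
    have disj: "disjoint_family_on B Z"
      unfolding disjoint_family_on_def
    proof (intro ballI impI)
      fix z w assume zw: "z \<in> Z" "w \<in> Z" "z \<noteq> w"
      then obtain b where b: "b \<in> Basis" "z \<bullet> b \<noteq> w \<bullet> b" using euclidean_eqI by blast
      obtain i j :: int where ij: "z \<bullet> b = of_int i" "w \<bullet> b = of_int j"
        using Z(2) zw b(1) by (metis Ints_cases)
      then have "\<bar>i - j\<bar> \<ge> 1" using b(2) by auto
      then have "\<bar>z \<bullet> b - w \<bullet> b\<bar> \<ge> 1" unfolding ij by linarith
      then have "\<bar>z \<bullet> b - w \<bullet> b\<bar> / real k \<ge> 1 / real k" by (rule divide_right_mono) simp
      then have far: "\<bar>(z \<bullet> b) / real k - (w \<bullet> b) / real k\<bar> \<ge> 2 * \<eta>"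
        by (simp add: \<eta>_def flip: diff_divide_distrib)
      show "B z \<inter> B w = {}"
      proof (rule ccontr)
        assume "B z \<inter> B w \<noteq> {}"
        then obtain x where "x \<in> B z" "x \<in> B w" by blast
        then show False using inB[of x z b] inB[of x w b] b(1) far by linarith
      qed
    qed
    have sub: "B z \<subseteq> C m" if z: "z \<in> Z" for z
    proof
      fix x assume x: "x \<in> B z"
      have "norm (x - z /\<^sub>R real k) \<le> (\<Sum>b\<in>Basis. \<bar>(x - z /\<^sub>R real k) \<bullet> b\<bar>)" by (rule norm_le_l1)
      also have "\<dots> \<le> (\<Sum>b\<in>(Basis::'a set). \<eta>)"
        using inB[OF x] by (intro sum_mono less_imp_le) (simp add: inner_diff_left divide_real_def mult.commute)
      also have "\<dots> = real DIM('a) * \<eta>" by simp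
      also have "\<dots> \<le> inverse (real (Suc m))"
      proof -
        have "real (DIM('a) * Suc m) \<le> real k" using k unfolding k0_def of_nat_le_iff .
        then have "real DIM('a) * real (Suc m) \<le> 2 * real k"
          unfolding of_nat_mult by linarith
        then show ?thesis using kpos by (simp add: \<eta>_def field_simps)
      qed
      finally have "x - z /\<^sub>R real k \<in> cball 0 (inverse (real (Suc m)))" by simp
      then have "\<exists>u\<in>K. \<exists>v\<in>cball 0 (inverse (real (Suc m))). x = u + v"
        using Z(3)[OF z] by (intro bexI[of _ "z /\<^sub>R real k"] bexI[of _ "x - z /\<^sub>R real k"]) auto
      then show "x \<in> C m" by (auto simp: C_def)
    qed
    have "real (card Z) * (1 / real k) ^ DIM('a) = (\<Sum>z\<in>Z. measure lborel (B z))" by (simp add: volB)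
    also have "\<dots> = measure lborel (\<Union>z\<in>Z. B z)"
    proof (rule measure_finite_Union[symmetric, OF Z(1) _ disj])
      show "emeasure lborel (B z) \<noteq> \<infinity>" for z
        using emeasure_bounded_finite[OF bounded_box] by (simp add: B_def less_top)
    qed (auto simp: B_def)
    also have "\<dots> \<le> measure lborel (C m)"
      using sub Z(1) by (intro measure_mono_fmeasurable measC) (auto simp: B_def)
    also have "\<dots> \<le> measure lborel K + \<epsilon>" using m by simp
    finally show ?thesis using kpos by (simp add: field_simps power_divide)
  qed
  show thesis by (rule that[OF \<open>k0 > 0\<close> bound])
qed

section \<open>Isolated zeros and the volume of the Newton polytope\<close>

definition lattice_point :: "('i::finite \<Rightarrow> 'a::euclidean_space) \<Rightarrow> ('i \<Rightarrow> nat) \<Rightarrow> 'a" where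
  "lattice_point e a = (\<Sum>i\<in>UNIV. real (a i) *\<^sub>R e i)"

lemma inner_lattice_point:
  assumes "bij_betw e UNIV Basis"
  shows "lattice_point e a \<bullet> e i = real (a i)"
proof -
  have "e j \<bullet> e i = (if j = i then 1 else 0)" for j
  proof -
    have "e j \<in> Basis" "e i \<in> Basis" "e j = e i \<longleftrightarrow> j = i"
      using assms by (auto simp: bij_betw_def inj_def)
    then show ?thesis by (simp add: inner_Basis)
  qed
  then have "lattice_point e a \<bullet> e i = (\<Sum>j\<in>UNIV. real (a j) * (if j = i then 1 else 0))"
    unfolding lattice_point_def inner_sum_left inner_scaleR_left by simp
  also have "\<dots> = real (a i)" by (simp add: if_distrib cong: if_cong)
  finally show ?thesis .
qed

text \<open>The average of \<open>k\<close> points of a convex set belongs to it.\<close>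

lemma lattice_point_iterated_sum:
  assumes "A \<noteq> {}" "a \<in> iterated_sum k A"
  shows "\<exists>x\<in>convex hull (lattice_point e ` A). lattice_point e a = real k *\<^sub>R x"
  using assms(2)
proof (induction k arbitrary: a)
  case 0
  then have "lattice_point e a = 0" by (simp add: lattice_point_def)
  moreover obtain x where "x \<in> convex hull (lattice_point e ` A)"
    using assms(1) by (metis convex_hull_eq_empty image_is_empty ex_in_conv)
  ultimately show ?case by auto
next
  case (Suc k)
  then obtain b c where bc: "b \<in> A" "c \<in> iterated_sum k A" "a = (\<lambda>i. b i + c i)"
    by (auto simp: exponent_sum_def)
  from Suc.IH[OF bc(2)] obtain x where x: "x \<in> convex hull (lattice_point e ` A)"
      "lattice_point e c = real k *\<^sub>R x" by blast
  define y where "y = (1 / real (Suc k)) *\<^sub>R lattice_point e b + (real k / real (Suc k)) *\<^sub>R x"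
  have "y \<in> convex hull (lattice_point e ` A)"
    unfolding y_def using x(1) bc(1)
    by (intro convexD[OF convex_convex_hull]) (auto simp: hull_inc field_simps)
  moreover have "lattice_point e a = lattice_point e b + lattice_point e c"
    by (simp add: bc lattice_point_def scaleR_add_left sum.distrib)
  then have "lattice_point e a = real (Suc k) *\<^sub>R y"
    by (simp add: y_def x(2) scaleR_add_right del: of_nat_Suc)
  ultimately show ?case by blast
qed

text \<open>The upper bound of Kushnirenko's theorem for isolated zeros that the monomials of \<open>A\<close> separate.
  With \<open>V\<close> the volume of the polytope, the preceding counts give
  \<open>|P| k^N / N! \<le> |P| #{\<alpha>. |\<alpha>| \<le> k} \<le> #((k + |P|) A) \<le> (k + |P|)^N (V + \<epsilon>)\<close>
  for large \<open>k\<close>; division by \<open>k^N\<close> and the limits \<open>k \<rightarrow> \<infinity>\<close>, \<open>\<epsilon> \<rightarrow> 0\<close> give \<open>|P| \<le> N! V\<close>.\<close>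

theorem isolated_zeros_le_normalized_volume:
  fixes f :: "complex ^ 'i::finite \<Rightarrow> complex ^ 'i" and e :: "'i \<Rightarrow> 'a::euclidean_space"
  assumes e: "bij_betw e UNIV Basis"
    and A: "finite A" "(\<lambda>_. 0) \<in> A" and f: "\<And>j. combination_of A (\<lambda>x. f x $ j)"
    and P: "finite P" "\<And>p. p \<in> P \<Longrightarrow> p isolated_in {x. f x = 0}"
    and sep: "\<And>p q. p \<in> P \<Longrightarrow> q \<in> P \<Longrightarrow> p \<noteq> q \<Longrightarrow> \<exists>a\<in>A. monomial a p \<noteq> monomial a q"
  shows "real (card P) \<le> normalized_volume (convex hull (lattice_point e ` A))"
proof -
  define K where "K = convex hull (lattice_point e ` A)"
  define N where "N = CARD('i)"
  have N: "N = DIM('a)" unfolding N_def using bij_betw_same_card[OF e] by simp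
  have "compact K" unfolding K_def using A(1) by (intro compact_convex_hull finite_imp_compact) simp
  have "real (card P) \<le> fact N * (measure lborel K + \<epsilon>)" if \<epsilon>: "\<epsilon> > 0" for \<epsilon>
  proof -
    obtain k0 where k0: "k0 > 0" "\<And>k Z. k \<ge> k0 \<Longrightarrow> finite Z \<Longrightarrow>
        (\<And>z b. z \<in> Z \<Longrightarrow> b \<in> Basis \<Longrightarrow> z \<bullet> b \<in> \<int>) \<Longrightarrow> (\<And>z. z \<in> Z \<Longrightarrow> z /\<^sub>R real k \<in> K) \<Longrightarrow>
        real (card Z) \<le> real k ^ DIM('a) * (measure lborel K + \<epsilon>)"
      by (fact lattice_points_in_dilation_le_volume[OF \<open>compact K\<close> \<epsilon>])
    have iter: "real (card (iterated_sum k A)) \<le> real k ^ N * (measure lborel K + \<epsilon>)" if "k \<ge> k0" for k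
    proof -
      have "inj (lattice_point e)"
      proof (rule injI, rule ext)
        fix a b i assume "lattice_point e a = lattice_point e b"
        then have "real (a i) = real (b i)" by (metis inner_lattice_point[OF e])
        then show "a i = b i" by simp
      qed
      then have "real (card (iterated_sum k A)) = real (card (lattice_point e ` iterated_sum k A))"
        by (simp add: card_image inj_on_subset)
      also have "\<dots> \<le> real k ^ DIM('a) * (measure lborel K + \<epsilon>)"
      proof (rule k0(2)[OF that])
        show "finite (lattice_point e ` iterated_sum k A)"
          using A(1) by (simp add: finite_iterated_sum)
        show "z \<bullet> b \<in> \<int>" if z: "z \<in> lattice_point e ` iterated_sum k A" and b: "b \<in> Basis" for z b
        proof -
          obtain i where "b = e i" using e b by (auto simp: bij_betw_def)
          moreover obtain a where "z = lattice_point e a" using z by blast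
          ultimately show ?thesis by (simp add: inner_lattice_point[OF e])
        qed
        show "z /\<^sub>R real k \<in> K" if z: "z \<in> lattice_point e ` iterated_sum k A" for z
        proof -
          obtain a where a: "a \<in> iterated_sum k A" "z = lattice_point e a" using z by blast
          obtain x where "x \<in> K" "z = real k *\<^sub>R x"
            using lattice_point_iterated_sum[OF _ a(1), of e] A(2) a(2) unfolding K_def by blast
          then show ?thesis using \<open>k \<ge> k0\<close> k0(1) by simp
        qed
      qed
      finally show ?thesis by (simp add: N)
    qed
    have main: "real (card P) * (real k / real (k + card P)) ^ N \<le> fact N * (measure lborel K + \<epsilon>)"
      if "k \<ge> k0" for k
    proof -
      have "real (card P) * real k ^ N
          \<le> real (card P) * (fact N * real (card (exponents_of_degree_le k :: ('i \<Rightarrow> nat) set)))"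
        unfolding N_def by (intro mult_left_mono power_le_card_exponents_of_degree_le) simp
      also have "\<dots> = fact N * real (card P * card (exponents_of_degree_le k :: ('i \<Rightarrow> nat) set))" by simp
      also have "\<dots> \<le> fact N * real (card (iterated_sum (k + card P) A))"
      proof (rule mult_left_mono)
        show "real (card P * card (exponents_of_degree_le k :: ('i \<Rightarrow> nat) set))
            \<le> real (card (iterated_sum (k + card P) A))"
          unfolding of_nat_le_iff by (rule isolated_zeros_count_le_exponents[OF A f P sep])
      qed simp
      also have "\<dots> \<le> fact N * (real (k + card P) ^ N * (measure lborel K + \<epsilon>))"
        using that by (intro mult_left_mono iter) auto
      finally have "real (card P) * real k ^ N \<le> fact N * (measure lborel K + \<epsilon>) * real (k + card P) ^ N"
        by (simp add: mult_ac)
      moreover have "real (k + card P) ^ N > 0" using that k0(1) by simp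
      ultimately show ?thesis by (simp add: power_divide divide_le_eq)
    qed
    have "(\<lambda>k. real k / real (k + card P)) \<longlonglongrightarrow> 1"
    proof (rule LIMSEQ_offset[where k = 1])
      have "(\<lambda>k. 1 - real (card P) * inverse (real (k + card P + 1))) \<longlonglongrightarrow> 1 - real (card P) * 0"
      proof (intro tendsto_intros)
        show "(\<lambda>k. inverse (real (k + card P + 1))) \<longlonglongrightarrow> 0"
          using LIMSEQ_ignore_initial_segment[OF LIMSEQ_inverse_real_of_nat, of "card P"] by simp
      qed
      moreover have "1 - real (card P) * inverse (real (k + card P + 1)) = real (k + 1) / real (k + 1 + card P)"
        for k by (simp add: field_simps)
      ultimately show "(\<lambda>k. real (k + 1) / real (k + 1 + card P)) \<longlonglongrightarrow> 1" by simp
    qed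
    then have "(\<lambda>k. real (card P) * (real k / real (k + card P)) ^ N) \<longlonglongrightarrow> real (card P) * 1 ^ N"
      by (intro tendsto_intros)
    then show ?thesis
      using LIMSEQ_le_const2 main by fastforce
  qed
  then have bound: "real (card P) \<le> fact N * measure lborel K + \<delta>" if "\<delta> > 0" for \<delta>
  proof -
    have "real (card P) \<le> fact N * (measure lborel K + \<delta> / fact N)"
      by (rule \<open>\<And>\<epsilon>. \<epsilon> > 0 \<Longrightarrow> real (card P) \<le> fact N * (measure lborel K + \<epsilon>)\<close>) (use that in simp)
    then show ?thesis by (simp add: distrib_left)
  qed
  then have "real (card P) \<le> fact N * measure lborel K" by (rule field_le_epsilon)
  then show ?thesis by (simp add: normalized_volume_def K_def N)
qed

section \<open>The load flow equations\<close>

definition pack :: "(complex ^ 'n::finite) \<times> (complex ^ 'n) \<Rightarrow> complex ^ ('n + 'n)" where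
  "pack = (\<lambda>(v, u). \<chi> i. case i of Inl j \<Rightarrow> v $ j | Inr j \<Rightarrow> u $ j)"

definition unpack :: "complex ^ ('n + 'n) \<Rightarrow> (complex ^ 'n::finite) \<times> (complex ^ 'n)" where
  "unpack x = (\<chi> j. x $ Inl j, \<chi> j. x $ Inr j)"

lemma unpack_pack [simp]: "unpack (pack p) = p"
  by (cases p) (simp add: unpack_def pack_def vec_eq_iff)

lemma pack_unpack [simp]: "pack (unpack x) = x"
  by (auto simp: unpack_def pack_def vec_eq_iff split: sum.split)

lemma continuous_on_unpack: "continuous_on S unpack"
  unfolding unpack_def
  by (intro continuous_on_Pair continuous_on_vec_lambda continuous_on_component continuous_on_id)

text \<open>The exponent vector of the monomial \<open>v\<^sub>i u\<^sub>j\<close> belonging to the ordered pair \<open>(i, j)\<close>, in which the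
  variable of the reference node is replaced by \<open>1\<close>.\<close>

definition edge_exponent :: "'n option \<times> 'n option \<Rightarrow> 'n + 'n \<Rightarrow> nat" where
  "edge_exponent = (\<lambda>(i, j) l. case l of Inl k \<Rightarrow> of_bool (i = Some k) | Inr k \<Rightarrow> of_bool (j = Some k))"

lemma zero_in_edge_exponents:
  assumes "loop_graph E"
  shows "(\<lambda>_. 0) \<in> edge_exponent ` E"
proof (rule image_eqI)
  show "(\<lambda>_. 0) = edge_exponent (None, None)"
    by (simp add: edge_exponent_def fun_eq_iff split: sum.split)
  show "(None, None) \<in> E" using assms by (auto simp: loop_graph_def refl_on_def)
qed

lemma prod_UNIV_sum:
  fixes f :: "'a::finite + 'b::finite \<Rightarrow> 'c::comm_monoid_mult"
  shows "prod f UNIV = (\<Prod>i\<in>UNIV. f (Inl i)) * (\<Prod>j\<in>UNIV. f (Inr j))"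
  by (subst UNIV_Plus_UNIV[symmetric], subst prod.Plus) simp_all

lemma sum_UNIV_sum:
  fixes f :: "'a::finite + 'b::finite \<Rightarrow> 'c::comm_monoid_add"
  shows "sum f UNIV = (\<Sum>i\<in>UNIV. f (Inl i)) + (\<Sum>j\<in>UNIV. f (Inr j))"
  by (subst UNIV_Plus_UNIV[symmetric], subst sum.Plus) simp_all

lemma monomial_edge_exponent:
  fixes v u :: "complex ^ 'n::finite"
  shows "monomial (edge_exponent (i, j)) (pack (v, u)) = with_ref 1 v i * with_ref 1 u j"
proof -
  have "(\<Prod>k\<in>UNIV. x $ k ^ of_bool (i = Some k)) = with_ref 1 x i" for x :: "complex ^ 'n" and i
  proof (cases i)
    case None
    then show ?thesis by (simp add: with_ref_def)
  next
    case (Some l)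
    have "(\<Prod>k\<in>UNIV. x $ k ^ of_bool (i = Some k)) = (\<Prod>k\<in>UNIV. if k = l then x $ k else 1)"
      by (intro prod.cong) (auto simp: Some)
    then show ?thesis by (simp add: Some with_ref_def)
  qed
  then show ?thesis
    by (simp add: monomial_def edge_exponent_def pack_def prod_UNIV_sum)
qed

definition unit_vec :: "'n::finite + 'n \<Rightarrow> (real ^ 'n) \<times> (real ^ 'n)" where
  "unit_vec l = (case l of Inl k \<Rightarrow> (axis k 1, 0) | Inr k \<Rightarrow> (0, axis k 1))"

lemma bij_betw_unit_vec: "bij_betw (unit_vec :: 'n::finite + 'n \<Rightarrow> _) UNIV Basis"
proof (rule bij_betwI')
  show "unit_vec x = unit_vec y \<longleftrightarrow> x = y" for x y :: "'n + 'n"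
    by (auto simp: unit_vec_def axis_eq_axis split: sum.splits)
  show "unit_vec x \<in> Basis" for x :: "'n + 'n"
    by (auto simp: unit_vec_def Basis_prod_def Basis_vec_def split: sum.splits)
  show "\<exists>x\<in>UNIV. y = unit_vec x" if "y \<in> Basis" for y :: "(real ^ 'n) \<times> (real ^ 'n)"
  proof -
    from that consider k where "y = (axis k 1, 0)" | k where "y = (0, axis k 1)"
      by (auto simp: Basis_prod_def Basis_vec_def)
    then show ?thesis
    proof cases
      case 1
      then show ?thesis by (intro bexI[of _ "Inl k"]) (simp_all add: unit_vec_def)
    next
      case 2
      then show ?thesis by (intro bexI[of _ "Inr k"]) (simp_all add: unit_vec_def)
    qed
  qed
qed

lemma lattice_point_edge_exponent:
  fixes i j :: "'n::finite option"
  shows "lattice_point unit_vec (edge_exponent (i, j)) = (node_vec i, node_vec j)"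
proof -
  have "(\<Sum>k\<in>UNIV. of_bool (i = Some k) *\<^sub>R axis k 1) = (node_vec i :: real ^ 'n)" for i
  proof (cases i)
    case None
    then show ?thesis by (simp add: node_vec_def)
  next
    case (Some l)
    have "(\<Sum>k\<in>UNIV. of_bool (i = Some k) *\<^sub>R axis k 1)
        = (\<Sum>k\<in>UNIV. if k = l then axis k 1 else 0 :: real ^ 'n)"
      by (intro sum.cong) (auto simp: Some)
    then show ?thesis by (simp add: Some node_vec_def)
  qed
  then show ?thesis
    by (simp add: lattice_point_def edge_exponent_def unit_vec_def sum_UNIV_sum prod_eq_iff
        fst_sum snd_sum)
qed

lemma adjacency_polytope_eq_hull:
  assumes "loop_graph E"
  shows "convex hull (lattice_point unit_vec ` edge_exponent ` E) = adjacency_polytope E"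
proof -
  have "lattice_point unit_vec ` edge_exponent ` E = adjacency_points E"
    by (force simp: adjacency_points_def lattice_point_edge_exponent image_image)
  moreover have "(None, None) \<in> E" using assms by (auto simp: loop_graph_def refl_on_def)
  then have "0 \<in> adjacency_points E"
    by (force simp: adjacency_points_def node_vec_def zero_prod_def)
  ultimately show ?thesis by (simp add: adjacency_polytope_def insert_absorb)
qed

definition load_flow_map ::
    "real \<Rightarrow> complex ^ ('n option) ^ ('n option) \<Rightarrow> complex ^ 'n::finite
      \<Rightarrow> complex ^ ('n + 'n) \<Rightarrow> complex ^ ('n + 'n)" where
  "load_flow_map v0 Y S x = (let (v, u) = unpack x in pack
     (\<chi> j. (\<Sum>k\<in>UNIV. cnj (Y $ Some j $ k) * v $ j * with_ref v0 u k) - S $ j,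
      \<chi> j. (\<Sum>k\<in>UNIV. Y $ Some j $ k * u $ j * with_ref v0 v k) - cnj (S $ j)))"

lemma load_flow_map_zeros:
  fixes S :: "complex ^ 'n::finite"
  shows "{x. load_flow_map v0 Y S x = 0} = {x. unpack x \<in> load_flow_solutions v0 Y S}"
proof -
  have "pack p = 0 \<longleftrightarrow> p = 0" for p :: "(complex ^ 'n) \<times> (complex ^ 'n)"
  proof
    assume "pack p = 0"
    then have "p = unpack 0" by (metis unpack_pack)
    then show "p = 0" by (simp add: unpack_def vec_eq_iff prod_eq_iff)
  qed (auto simp: pack_def zero_prod_def vec_eq_iff split: sum.split)
  then show ?thesis
    by (auto simp: load_flow_map_def load_flow_solutions_def split_beta Let_def vec_eq_iff prod_eq_iff)
qed

lemma isolated_in_pack: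
  assumes "p isolated_in load_flow_solutions v0 Y S"
  shows "pack p isolated_in {x. load_flow_map v0 Y S x = 0}"
proof -
  obtain T where T: "open T" "T \<inter> load_flow_solutions v0 Y S = {p}"
    using assms by (auto simp: isolated_in_def)
  have "open (unpack -` T)" by (intro open_vimage T(1) continuous_on_unpack)
  moreover have "(unpack -` T) \<inter> {x. load_flow_map v0 Y S x = 0} = {pack p}"
  proof -
    have "x \<in> (unpack -` T) \<inter> {x. load_flow_map v0 Y S x = 0} \<longleftrightarrow> unpack x = p" for x
      unfolding load_flow_map_zeros using T(2) by auto
    moreover have "unpack x = p \<longleftrightarrow> x = pack p" for x by auto
    ultimately show ?thesis by blast
  qed
  ultimately show ?thesis unfolding isolated_in_def by blast
qed

lemma with_ref_factor: "with_ref c x k = (if k = None then of_real c else 1) * with_ref 1 x k"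
  by (simp add: with_ref_def split: option.split)

text \<open>The first kind of equation at node \<open>j\<close> involves \<open>v\<^sub>j u\<^sub>k\<close> with \<open>(j, k)\<close> an edge.  The second kind involves
  \<open>u\<^sub>j v\<^sub>k\<close>, which belongs to the pair \<open>(k, j)\<close>, an edge by symmetry.  The constants belong to the loop at
  the reference node.\<close>

lemma combination_of_load_flow_map:
  fixes S :: "complex ^ 'n::finite"
  assumes "loop_graph E" "admittance_matrix E Y"
  shows "combination_of (edge_exponent ` E) (\<lambda>x. load_flow_map v0 Y S x $ l)"
proof -
  let ?A = "edge_exponent ` E"
  let ?\<rho> = "\<lambda>k. if k = None then of_real v0 else 1"
  have fin: "finite ?A" by simp
  have zero: "(\<lambda>_. 0) \<in> ?A"
    by (rule zero_in_edge_exponents[OF assms(1)])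
  have E: "(j, k) \<in> E" "(k, j) \<in> E" if "Y $ j $ k \<noteq> 0" for j k
    using assms that by (auto simp: admittance_matrix_def loop_graph_def sym_def)
  have scaled: "combination_of ?A (\<lambda>x. c * monomial (edge_exponent e) x)"
    if "c \<noteq> 0 \<Longrightarrow> e \<in> E" for c e
  proof (cases "c = 0")
    case True
    then have "combination_of ?A (\<lambda>x. c * monomial (\<lambda>_. 0) x)"
      by (intro combination_of_cmult combination_of_monomial zero fin)
    then show ?thesis using True by simp
  next
    case False
    then show ?thesis using that by (intro combination_of_cmult combination_of_monomial fin) auto
  qed
  have mono: "monomial (edge_exponent (i, j)) x = with_ref 1 (fst (unpack x)) i * with_ref 1 (snd (unpack x)) j"
    for i j and x :: "complex ^ ('n + 'n)"
    using monomial_edge_exponent[of i j "fst (unpack x)" "snd (unpack x)"] by simp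
  have someref: "with_ref 1 y (Some j) = y $ j" for y :: "complex ^ 'n" and j
    by (simp add: with_ref_def)
  show ?thesis
  proof (cases l)
    case (Inl j)
    have "load_flow_map v0 Y S x $ l
        = (\<Sum>k\<in>UNIV. (cnj (Y $ Some j $ k) * ?\<rho> k) * monomial (edge_exponent (Some j, k)) x)
          + (- S $ j) * monomial (\<lambda>_. 0) x" for x
      by (simp add: Inl load_flow_map_def pack_def split_beta Let_def mono someref
          with_ref_factor[of v0] mult_ac)
    moreover have "combination_of ?A (\<lambda>x.
        (\<Sum>k\<in>UNIV. (cnj (Y $ Some j $ k) * ?\<rho> k) * monomial (edge_exponent (Some j, k)) x)
          + (- S $ j) * monomial (\<lambda>_. 0) x)"
      by (intro combination_of_add combination_of_sum scaled combination_of_cmult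
          combination_of_monomial zero fin) (use E in auto)
    ultimately show ?thesis by simp
  next
    case (Inr j)
    have "load_flow_map v0 Y S x $ l
        = (\<Sum>k\<in>UNIV. (Y $ Some j $ k * ?\<rho> k) * monomial (edge_exponent (k, Some j)) x)
          + (- cnj (S $ j)) * monomial (\<lambda>_. 0) x" for x
      by (simp add: Inr load_flow_map_def pack_def split_beta Let_def mono someref
          with_ref_factor[of v0] mult_ac)
    moreover have "combination_of ?A (\<lambda>x.
        (\<Sum>k\<in>UNIV. (Y $ Some j $ k * ?\<rho> k) * monomial (edge_exponent (k, Some j)) x)
          + (- cnj (S $ j)) * monomial (\<lambda>_. 0) x)"
      by (intro combination_of_add combination_of_sum scaled combination_of_cmult
          combination_of_monomial zero fin) (use E in auto)
    ultimately show ?thesis by simp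
  qed
qed

text \<open>On a set of nodes without an edge to the rest of the graph and without the reference node,
  multiplying all \<open>v\<close> by \<open>\<lambda>\<close> and all \<open>u\<close> by \<open>1/\<lambda>\<close> does not change any product \<open>v\<^sub>j u\<^sub>k\<close> in the
  equations, so solutions come in curves.\<close>

lemma isolated_solution_imp_reachable:
  assumes E: "loop_graph E" "admittance_matrix E Y"
    and p: "p \<in> algebraic_torus" "p isolated_in load_flow_solutions v0 Y S"
  shows "(None, i) \<in> E\<^sup>*"
proof (rule ccontr)
  assume i: "(None, i) \<notin> E\<^sup>*"
  define R where "R = {k. (None, k) \<in> E\<^sup>*}"
  have R: "None \<in> R" "i \<notin> R" using i by (auto simp: R_def)
  have edge: "j \<in> R \<longleftrightarrow> k \<in> R" if "(j, k) \<in> E" for j k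
  proof -
    have "(k, j) \<in> E" using E(1) that by (auto simp: loop_graph_def sym_def)
    then show ?thesis using that unfolding R_def by (auto intro: rtrancl_into_rtrancl)
  qed
  obtain l where l: "i = Some l" using R by (cases i) auto
  obtain v u where vu: "p = (v, u)" by (cases p)
  define scale where "scale = (\<lambda>z::complex.
      ((\<chi> j. (if Some j \<in> R then 1 else z) * v $ j), (\<chi> j. (if Some j \<in> R then 1 else inverse z) * u $ j)))"
  have ref: "with_ref v0 (\<chi> j. (if Some j \<in> R then 1 else z) * y $ j) k
      = (if k \<in> R then 1 else z) * with_ref v0 y k" for z y k
    using R(1) by (auto simp: with_ref_def split: option.split)
  have sol: "scale z \<in> load_flow_solutions v0 Y S" if z: "z \<noteq> 0" for z
  proof -
    have Y0: "Y $ j $ k = 0" if "(j \<in> R) \<noteq> (k \<in> R)" for j k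
      using E(2) edge that by (auto simp: admittance_matrix_def)
    have 1: "cnj (Y $ Some j $ k) * ((if Some j \<in> R then 1 else z) * v $ j)
        * ((if k \<in> R then 1 else inverse z) * with_ref v0 u k)
        = cnj (Y $ Some j $ k) * v $ j * with_ref v0 u k" for j k
      using Y0[of "Some j" k] z by auto
    have 2: "Y $ Some j $ k * ((if Some j \<in> R then 1 else inverse z) * u $ j)
        * ((if k \<in> R then 1 else z) * with_ref v0 v k)
        = Y $ Some j $ k * u $ j * with_ref v0 v k" for j k
      using Y0[of "Some j" k] z by auto
    have "(v, u) \<in> load_flow_solutions v0 Y S" using p(2) vu by (simp add: isolated_in_def)
    then show ?thesis
      unfolding load_flow_solutions_def scale_def mem_Collect_eq prod.case ref vec_lambda_beta 1 2 .
  qed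
  obtain e where e: "e > 0" "\<And>q. q \<in> load_flow_solutions v0 Y S \<Longrightarrow> dist p q < e \<Longrightarrow> q = p"
    using p(2) unfolding isolated_in_dist_Ex_iff by blast
  have "(scale \<longlongrightarrow> p) (at 1)"
  proof -
    have "(scale \<longlongrightarrow> ((\<chi> j. (if Some j \<in> R then 1 else 1) * v $ j),
        (\<chi> j. (if Some j \<in> R then 1 else inverse 1) * u $ j))) (at 1)"
      unfolding scale_def
    proof (intro tendsto_Pair vec_tendstoI)
      show "((\<lambda>z. (\<chi> j. (if Some j \<in> R then 1 else z) * v $ j) $ j) \<longlongrightarrow>
          (\<chi> j. (if Some j \<in> R then 1 else 1) * v $ j) $ j) (at 1)" for j
        by (cases "Some j \<in> R") (auto intro!: tendsto_eq_intros)
      show "((\<lambda>z. (\<chi> j. (if Some j \<in> R then 1 else inverse z) * u $ j) $ j) \<longlongrightarrow>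
          (\<chi> j. (if Some j \<in> R then 1 else inverse 1) * u $ j) $ j) (at 1)" for j
        by (cases "Some j \<in> R") (auto intro!: tendsto_eq_intros)
    qed
    then show ?thesis by (simp add: vu cong: if_cong)
  qed
  then have "eventually (\<lambda>z. dist (scale z) p < e) (at 1)" using e(1) by (rule tendstoD)
  moreover have "eventually (\<lambda>z::complex. z \<noteq> 0) (at 1)"
    by (rule tendsto_imp_eventually_ne[OF tendsto_ident_at]) simp
  moreover have "eventually (\<lambda>z::complex. z \<noteq> 1) (at 1)" by (simp add: eventually_at_filter)
  ultimately have "eventually (\<lambda>z. dist (scale z) p < e \<and> z \<noteq> 0 \<and> z \<noteq> 1) (at 1)"
    by (intro eventually_conj)
  then obtain z where z: "dist (scale z) p < e" "z \<noteq> 0" "z \<noteq> 1"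
    using eventually_happens[of _ "at (1::complex)"] by auto
  then have "scale z = p" using e(2)[OF sol[OF z(2)]] by (simp add: dist_commute)
  then have "fst (scale z) $ l = v $ l" by (simp add: vu)
  then have "z * v $ l = v $ l" using R(2) by (simp add: scale_def l)
  moreover have "v $ l \<noteq> 0" using p(1) vu by (auto simp: algebraic_torus_def)
  ultimately show False using z(3) by simp
qed

text \<open>The reference node has the same value in both points.  Along an edge \<open>(j, k)\<close>, the products \<open>v\<^sub>j u\<^sub>k\<close>
  and \<open>v\<^sub>k u\<^sub>j\<close> determine the values at \<open>k\<close> from the nonzero values at \<open>j\<close>.\<close>

lemma edge_monomials_separate_torus_points:
  assumes E: "sym E" "\<And>i. (None, i) \<in> E\<^sup>*"
    and pq: "p \<in> algebraic_torus" "q \<in> algebraic_torus" "p \<noteq> q"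
  shows "\<exists>a\<in>edge_exponent ` E. monomial a (pack p) \<noteq> monomial a (pack q)"
proof (rule ccontr)
  assume "\<not> ?thesis"
  then have same: "\<And>e. e \<in> E \<Longrightarrow> monomial (edge_exponent e) (pack p) = monomial (edge_exponent e) (pack q)"
    by blast
  obtain v u v' u' where vu: "p = (v, u)" "q = (v', u')" by (cases p, cases q) blast
  have prods: "with_ref 1 v i * with_ref 1 u j = with_ref 1 v' i * with_ref 1 u' j" if "(i, j) \<in> E" for i j
    using same[OF that] by (simp add: vu monomial_edge_exponent)
  have nz: "with_ref 1 v i \<noteq> 0" "with_ref 1 u i \<noteq> 0" for i
    using pq(1) by (auto simp: vu algebraic_torus_def with_ref_def split: option.split)
  have agree: "with_ref 1 v i = with_ref 1 v' i \<and> with_ref 1 u i = with_ref 1 u' i" for i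
    using E(2)[of i]
  proof induction
    case base
    show ?case by (simp add: with_ref_def)
  next
    case (step j k)
    then have "(k, j) \<in> E" using E(1) by (auto simp: sym_def)
    then show ?case using prods[OF step(2)] prods[of k j] step.IH nz[of j] by simp
  qed
  have "v $ j = v' $ j \<and> u $ j = u' $ j" for j
    using agree[of "Some j"] by (simp add: with_ref_def)
  then show False using pq(3) by (simp add: vu vec_eq_iff)
qed

theorem theorem4:
  fixes E :: "('n::finite option \<times> 'n option) set"
    and Y :: "complex ^ ('n option) ^ ('n option)"
    and S :: "complex ^ 'n"
    and v0 :: real
  assumes "loop_graph E"
    and "admittance_matrix E Y"
    and "v0 \<noteq> 0"
  shows "finite {x \<in> algebraic_torus. x isolated_in load_flow_solutions v0 Y S} \<and>
    real (card {x \<in> algebraic_torus. x isolated_in load_flow_solutions v0 Y S}) \<le> ap_bound E"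
proof -
  define X where "X = {x \<in> algebraic_torus. x isolated_in load_flow_solutions v0 Y S}"
  have bound: "real (card Q) \<le> ap_bound E" if Q: "finite Q" "Q \<subseteq> X" for Q
  proof -
    have inj: "inj_on pack Q" by (metis inj_onI unpack_pack)
    have "real (card (pack ` Q)) \<le> normalized_volume (convex hull (lattice_point unit_vec ` edge_exponent ` E))"
    proof (rule isolated_zeros_le_normalized_volume[where f = "load_flow_map v0 Y S", OF bij_betw_unit_vec])
      show "(\<lambda>_. 0) \<in> edge_exponent ` E" by (rule zero_in_edge_exponents[OF assms(1)])
      show "x isolated_in {x. load_flow_map v0 Y S x = 0}" if "x \<in> pack ` Q" for x
      proof -
        obtain p where p: "x = pack p" "p \<in> X" using \<open>x \<in> pack ` Q\<close> Q(2) by blast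
        show ?thesis unfolding p(1) by (rule isolated_in_pack) (use p(2) in \<open>simp add: X_def\<close>)
      qed
      show "\<exists>a\<in>edge_exponent ` E. monomial a x \<noteq> monomial a y"
        if xy: "x \<in> pack ` Q" "y \<in> pack ` Q" "x \<noteq> y" for x y
      proof -
        obtain p q where pq: "x = pack p" "y = pack q" "p \<in> X" "q \<in> X" "p \<noteq> q" using xy Q(2) by blast
        show ?thesis unfolding pq(1,2)
        proof (rule edge_monomials_separate_torus_points)
          show "(None, i) \<in> E\<^sup>*" for i
            by (rule isolated_solution_imp_reachable[OF assms(1,2), of p v0 S])
              (use pq(3) in \<open>simp_all add: X_def\<close>)
        qed (use pq assms(1) in \<open>auto simp: X_def loop_graph_def\<close>)
      qed
    qed (use Q(1) combination_of_load_flow_map[OF assms(1,2)] in auto)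
    then show ?thesis
      by (simp add: card_image[OF inj] adjacency_polytope_eq_hull[OF assms(1)] ap_bound_def)
  qed
  have "finite X"
  proof (rule ccontr)
    assume "infinite X"
    then obtain Q where Q: "finite Q" "card Q = Suc (nat \<lceil>ap_bound E\<rceil>)" "Q \<subseteq> X"
      using infinite_arbitrarily_large by blast
    then have "real (Suc (nat \<lceil>ap_bound E\<rceil>)) \<le> ap_bound E" using bound by metis
    then show False by linarith
  qed
  then show ?thesis using bound[of X] by (simp add: X_def)
qed

end
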